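(* Let $p$ be a prime, let $K$ be a finite extension of $\mathbb{Q}_p$, and let $N/K$ be a fully (totally) ramified Galois extension with $G=\mathrm{Gal}(N/K)$ elementary abelian of order $[N:K]=p^n$. Let $b_{\max}$ denote the largest lower ramification break of $N/K$. Assume that every upper ramification break of $N/K$ is relatively prime to $p$. Then every $\alpha\in N$ with $v_N(\alpha)\equiv b_{\max}\pmod{[N:K]}$ generates a normal basis of $N$ over $K$, i.e. $\{\sigma\alpha:\sigma\in G\}$ is a $K$-basis of $N$. Moreover, no other residue class has this property: for every integer $v$ with $v\not\equiv b_{\max}\pmod{[N:K]}$ there exists $\rho_v\in N$ with $v_N(\rho_v)=v$ such that $\rho_v$ does not generate a normal basis of $N$ over $K$.
   Context: $v_N$ denotes the valuation on $N$ normalized so that $v_N(\pi_N)=1$ for a prime element $\pi_N$ of $N$. For an integer $i\ge -1$, the $i$th lower ramification group is $G_i=\{\sigma\in G: v_N((\sigma-1)\pi_N)\ge i+1\}$. The lower ramification breaks $b_1<\dots<b_m$ are the integers $b$ with $G_b\supsetneq G_{b+1}$; $b_{\max}=b_m$. With $g_i=|G_i|$, the upper ramification breaks $u_1<\dots<u_m$ are given by $u_1=b_1$ and $u_i=\big(b_1g_{b_1}+(b_2-b_1)g_{b_2}+\dots+(b_i-b_{i-1})g_{b_i}\big)/p^n$ for $i\ge2$. *)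

theory Defs
  imports Complex_Main "HOL-Computational_Algebra.Primes" "HOL-Number_Theory.Cong"
begin

definition padic_abs :: "nat \<Rightarrow> rat \<Rightarrow> real" where
  "padic_abs p x =
     (if x = 0 then 0
      else real p powi
        (int (multiplicity (int p) (snd (quotient_of x)))
         - int (multiplicity (int p) (fst (quotient_of x)))))"

text \<open>
  The field \<open>'q\<close> with absolute value \<open>a\<close> is the field of p-adic numbers, i.e. the completion
  of the rationals with respect to the p-adic absolute value: it is complete, and the rationals
  embed isometrically with dense image. This determines \<open>('q, a)\<close> up to unique isometric
  isomorphism.
\<close>

definition is_padic_field :: "nat \<Rightarrow> ('q::field_char_0 \<Rightarrow> real) \<Rightarrow> bool" where
  "is_padic_field p a \<longleftrightarrow>
     (\<forall>x. a x \<ge> 0) \<and> (\<forall>x. a x = 0 \<longleftrightarrow> x = 0) \<and>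
     (\<forall>x y. a (x * y) = a x * a y) \<and>
     (\<forall>x y. a (x + y) \<le> a x + a y) \<and>
     (\<forall>r. a (of_rat r) = padic_abs p r) \<and>
     (\<forall>x. \<forall>e>0. \<exists>r. a (x - of_rat r) < e) \<and>
     (\<forall>X :: nat \<Rightarrow> 'q.
        (\<forall>e>0. \<exists>M. \<forall>m\<ge>M. \<forall>n\<ge>M. a (X m - X n) < e) \<longrightarrow>
        (\<exists>L. (\<lambda>n. a (X n - L)) \<longlonglongrightarrow> 0))"

text \<open>
  An extension of fields is given by the two fields as types together with an embedding \<open>f\<close>
  of the smaller one into the larger one, which turns the larger field into a vector space.
\<close>

definition field_embedding :: "('k::field \<Rightarrow> 'n::field) \<Rightarrow> bool" where
  "field_embedding f \<longleftrightarrow>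
     f 1 = 1 \<and> (\<forall>x y. f (x + y) = f x + f y) \<and> (\<forall>x y. f (x * y) = f x * f y)"

definition ext_scale :: "('k::field \<Rightarrow> 'n::field) \<Rightarrow> 'k \<Rightarrow> 'n \<Rightarrow> 'n" where
  "ext_scale f c x = f c * x"

lemma vector_space_ext_scale:
  assumes "field_embedding f"
  shows "vector_space (ext_scale f)"
  using assms
  by unfold_locales (auto simp: field_embedding_def ext_scale_def algebra_simps)

definition finite_extension :: "('k::field \<Rightarrow> 'n::field) \<Rightarrow> bool" where
  "finite_extension f \<longleftrightarrow>
     field_embedding f \<and> (\<exists>B. finite B \<and> module.span (ext_scale f) B = UNIV)"

definition ext_degree :: "('k::field \<Rightarrow> 'n::field) \<Rightarrow> nat" where
  "ext_degree f = vector_space.dim (ext_scale f) UNIV"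

definition galois_group :: "('k::field \<Rightarrow> 'n::field) \<Rightarrow> ('n \<Rightarrow> 'n) set" where
  "galois_group f = {\<sigma>. field_embedding \<sigma> \<and> bij \<sigma> \<and> (\<forall>c. \<sigma> (f c) = f c)}"

definition galois_extension :: "('k::field \<Rightarrow> 'n::field) \<Rightarrow> bool" where
  "galois_extension f \<longleftrightarrow>
     finite_extension f \<and> {x. \<forall>\<sigma>\<in>galois_group f. \<sigma> x = x} = range f"

definition elementary_abelian :: "nat \<Rightarrow> ('n \<Rightarrow> 'n) set \<Rightarrow> bool" where
  "elementary_abelian p G \<longleftrightarrow>
     (\<forall>\<sigma>\<in>G. \<forall>\<tau>\<in>G. \<sigma> \<circ> \<tau> = \<tau> \<circ> \<sigma>) \<and> (\<forall>\<sigma>\<in>G. \<sigma> ^^ p = id)"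

definition generates_normal_basis :: "('k::field \<Rightarrow> 'n::field) \<Rightarrow> 'n \<Rightarrow> bool" where
  "generates_normal_basis f \<alpha> \<longleftrightarrow>
     \<not> module.dependent (ext_scale f) ((\<lambda>\<sigma>. \<sigma> \<alpha>) ` galois_group f) \<and>
     module.span (ext_scale f) ((\<lambda>\<sigma>. \<sigma> \<alpha>) ` galois_group f) = UNIV"

text \<open>
  Valuations are integer-valued functions whose value at 0 is irrelevant; the convention that
  the valuation of 0 is infinite is made explicit wherever it matters. The last conjunct says
  that \<open>v\<close> lies above the p-adic valuation: for an embedding \<open>j\<close> of the p-adic numbers with
  absolute value \<open>a\<close>, the restriction of \<open>v\<close> is \<open>e\<close> times the p-adic valuation.
\<close>

definition normalized_valuation ::
  "nat \<Rightarrow> ('q::field \<Rightarrow> real) \<Rightarrow> ('q \<Rightarrow> 'n::field) \<Rightarrow> ('n \<Rightarrow> int) \<Rightarrow> bool" where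
  "normalized_valuation p a j v \<longleftrightarrow>
     (\<forall>x y. x \<noteq> 0 \<longrightarrow> y \<noteq> 0 \<longrightarrow> v (x * y) = v x + v y) \<and>
     (\<forall>x y. x \<noteq> 0 \<longrightarrow> y \<noteq> 0 \<longrightarrow> x + y \<noteq> 0 \<longrightarrow> min (v x) (v y) \<le> v (x + y)) \<and>
     (\<exists>x. x \<noteq> 0 \<and> v x = 1) \<and>
     (\<exists>e>0. \<forall>x. x \<noteq> 0 \<longrightarrow> a x = real p powr (- real_of_int (v (j x)) / e))"

definition prime_element :: "('n::field \<Rightarrow> int) \<Rightarrow> 'n \<Rightarrow> bool" where
  "prime_element v \<pi> \<longleftrightarrow> \<pi> \<noteq> 0 \<and> v \<pi> = 1"

text \<open>
  The ramification index is the index of the value group of the smaller field in that of the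
  larger one, which is \<open>\<int>\<close> for a normalized valuation; in a totally ramified extension it equals
  the degree.
\<close>

definition totally_ramified :: "('k::field \<Rightarrow> 'n::field) \<Rightarrow> ('n \<Rightarrow> int) \<Rightarrow> bool" where
  "totally_ramified f v \<longleftrightarrow> v ` (range f - {0}) = {m. int (ext_degree f) dvd m}"

definition lower_ram_group ::
  "('k::field \<Rightarrow> 'n::field) \<Rightarrow> ('n \<Rightarrow> int) \<Rightarrow> 'n \<Rightarrow> int \<Rightarrow> ('n \<Rightarrow> 'n) set" where
  "lower_ram_group f v \<pi> i =
     {\<sigma> \<in> galois_group f. \<sigma> \<pi> - \<pi> = 0 \<or> v (\<sigma> \<pi> - \<pi>) \<ge> i + 1}"

definition lower_breaks ::
  "('k::field \<Rightarrow> 'n::field) \<Rightarrow> ('n \<Rightarrow> int) \<Rightarrow> 'n \<Rightarrow> int set" where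
  "lower_breaks f v \<pi> =
     {b. b \<ge> -1 \<and> lower_ram_group f v \<pi> (b + 1) \<subset> lower_ram_group f v \<pi> b}"

text \<open>The list of lower breaks in increasing order is indexed from 0 here.\<close>

definition upper_break ::
  "('k::field \<Rightarrow> 'n::field) \<Rightarrow> ('n \<Rightarrow> int) \<Rightarrow> 'n \<Rightarrow> nat \<Rightarrow> rat" where
  "upper_break f v \<pi> i =
     (let b = (\<lambda>j. sorted_list_of_set (lower_breaks f v \<pi>) ! j);
          g = (\<lambda>k. int (card (lower_ram_group f v \<pi> k)))
      in if i = 0 then of_int (b 0)
         else of_int (b 0 * g (b 0) + (\<Sum>j=1..i. (b j - b (j - 1)) * g (b j)))
              / of_nat (ext_degree f))"

definition upper_breaks ::
  "('k::field \<Rightarrow> 'n::field) \<Rightarrow> ('n \<Rightarrow> int) \<Rightarrow> 'n \<Rightarrow> rat set" where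
  "upper_breaks f v \<pi> = upper_break f v \<pi> ` {..<card (lower_breaks f v \<pi>)}"

end

theory Submission
  imports Defs "HOL-Computational_Algebra.Polynomial" "HOL-Algebra.Generated_Groups"
begin

text \<open>
  Let \<open>b(g)\<close> be the break of \<open>g\<close>, so \<open>v(g \<pi> - \<pi>) = b(g) + 1\<close>. An element \<open>\<alpha>\<close> generates a normal
  basis iff its trace to the fixed field \<open>L\<close> of every subgroup \<open>H\<close> of index \<open>p\<close> does so over \<open>K\<close>.
  By Euler's formula \<open>\<pi>\<^sup>d\<^sup>-\<^sup>1\<close> (\<open>d = |H|\<close>) divided by the derivative of the minimal polynomial of
  \<open>\<pi>\<close> over \<open>L\<close> has trace 1, and higher powers have traces of positive valuation; so the trace raises
  the valuation by exactly the sum of \<open>b\<close> over \<open>H - {1}\<close> whenever the result is divisible by \<open>d\<close>.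
  By Herbrand's theorem the break \<open>u\<close> of \<open>L/K\<close> is an upper break of \<open>N/K\<close>, and integrality of the
  upper breaks makes the valuation of the trace of \<open>\<alpha>\<close> in \<open>L\<close> congruent to \<open>u\<close> modulo \<open>p\<close>. As
  \<open>p\<close> does not divide \<open>u\<close>, the differences \<open>(\<sigma> - 1)\<^sup>k\<close> of this trace, \<open>k < p\<close>, have valuations
  incongruent modulo \<open>p\<close>, hence are independent over \<open>K\<close>. In the other residue classes Euler's
  formula over \<open>K\<close> gives elements of trace 0.
\<close>

subsection \<open>Field homomorphisms\<close>

locale field_hom = additive s
  for s :: "'a::field \<Rightarrow> 'b::field" +
  assumes one: "s 1 = 1"
    and mult: "s (x * y) = s x * s y"
begin

lemma prod: "s (prod g A) = (\<Prod>x\<in>A. s (g x))"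
  by (induction A rule: infinite_finite_induct) (simp_all add: one mult)

lemma power: "s (x ^ k) = s x ^ k"
  by (induction k) (simp_all add: one mult)

lemma of_nat: "s (of_nat k) = of_nat k"
  by (induction k) (simp_all add: zero one add)

lemma eq_0_iff [simp]: "s x = 0 \<longleftrightarrow> x = 0"
  using mult[of x "inverse x"] by (cases "x = 0") (auto simp: zero one)

lemma inverse: "s (inverse x) = inverse (s x)"
  using mult[of x "inverse x"] by (cases "x = 0") (auto simp: zero one inverse_unique)

lemma divide: "s (x / y) = s x / s y"
  by (simp add: divide_inverse mult inverse)

lemma power_int: "s (x powi k) = s x powi k"
  by (simp add: power_int_def power inverse)

lemmas homs = zero one add minus diff sum mult prod power of_nat inverse divide power_int

lemma map_poly_mult: "map_poly s (a * b) = map_poly s a * map_poly s b"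
  by (rule poly_eqI) (simp add: coeff_map_poly coeff_mult homs)

lemma map_poly_prod: "map_poly s (prod g A) = (\<Prod>x\<in>A. map_poly s (g x))"
  by (induction A rule: infinite_finite_induct) (simp_all add: map_poly_mult map_poly_1' one)

end

lemma field_embedding_iff: "field_embedding s \<longleftrightarrow> field_hom s"
  by (auto simp: field_embedding_def field_hom_def field_hom_axioms_def additive_def)

subsection \<open>Bases given by families\<close>

lemma (in vector_space) inj_on_independent_family:
  assumes "finite I"
    and indep: "\<And>c. (\<Sum>i\<in>I. c i *s w i) = 0 \<Longrightarrow> \<forall>i\<in>I. c i = 0"
  shows "inj_on w I"
proof (rule inj_onI, rule ccontr)
  fix i k assume collision: "i \<in> I" "k \<in> I" "w i = w k" "i \<noteq> k"
  define c :: "_ \<Rightarrow> 'a" where "c l = (if l = i then 1 else if l = k then -1 else 0)" for l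
  have "(\<Sum>l\<in>I. c l *s w l) = (\<Sum>l\<in>{i, k}. c l *s w l)"
    by (rule sum.mono_neutral_right) (use collision assms(1) in \<open>auto simp: c_def\<close>)
  also have "\<dots> = 0"
    using collision by (simp add: c_def)
  finally show False
    using indep[of c] collision(1) by (auto simp: c_def)
qed

lemma (in finite_dimensional_vector_space) independent_family_iff_basis:
  assumes card_I: "finite I" "card I = dim UNIV"
  shows "(\<forall>c. (\<Sum>i\<in>I. c i *s w i) = 0 \<longrightarrow> (\<forall>i\<in>I. c i = 0)) \<longleftrightarrow>
    independent (w ` I) \<and> span (w ` I) = UNIV"
proof (intro iffI allI impI)
  assume indep: "\<forall>c. (\<Sum>i\<in>I. c i *s w i) = 0 \<longrightarrow> (\<forall>i\<in>I. c i = 0)"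
  then have inj_w: "inj_on w I"
    by (intro inj_on_independent_family[OF card_I(1)]) blast
  have "independent (w ` I)"
  proof (rule independent_if_scalars_zero)
    fix u x assume "(\<Sum>x\<in>w ` I. u x *s x) = 0" "x \<in> w ` I"
    then show "u x = 0"
      using indep[rule_format, of "\<lambda>i. u (w i)"] by (auto simp: sum.reindex[OF inj_w])
  qed (simp add: card_I(1))
  moreover have "card (w ` I) = dim UNIV"
    using card_I(2) by (simp only: card_image[OF inj_w])
  ultimately show "independent (w ` I) \<and> span (w ` I) = UNIV"
    using card_eq_dim[of "w ` I" UNIV] card_I(1) by auto
next
  fix c assume basis: "independent (w ` I) \<and> span (w ` I) = UNIV"
    and relation: "(\<Sum>i\<in>I. c i *s w i) = 0"
  have "card (w ` I) = card I"
    using basis_card_eq_dim[of "w ` I" UNIV] basis card_I(2) by simp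
  then have inj_w: "inj_on w I"
    by (rule eq_card_imp_inj_on[OF card_I(1)])
  have "(\<Sum>x\<in>w ` I. c (the_inv_into I w x) *s x) = 0"
    using relation by (simp add: sum.reindex[OF inj_w] the_inv_into_f_f[OF inj_w])
  then have "c (the_inv_into I w (w i)) = 0" if "i \<in> I" for i
    using basis that card_I(1) independentD[of "w ` I" "w ` I" "\<lambda>x. c (the_inv_into I w x)"] by auto
  then show "\<forall>i\<in>I. c i = 0"
    by (simp add: the_inv_into_f_f[OF inj_w])
qed

lemma finite_extension_vector_space:
  assumes "finite_extension f"
  obtains B where "finite_dimensional_vector_space (ext_scale f) B"
proof -
  obtain S where emb: "field_embedding f"
    and spanning: "finite S" "module.span (ext_scale f) S = UNIV"
    using assms by (auto simp: finite_extension_def)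
  interpret vector_space "ext_scale f"
    by (rule vector_space_ext_scale[OF emb])
  obtain B where basis: "B \<subseteq> S" "independent B" "S \<subseteq> span B"
    using maximal_independent_subset by blast
  have "span B = UNIV"
    using span_mono[OF basis(3)] spanning(2) by (simp add: span_span top_unique)
  then have "finite_dimensional_vector_space (ext_scale f) B"
    using basis(2) finite_subset[OF basis(1) spanning(1)] by unfold_locales
  then show thesis
    by (rule that)
qed

lemma ext_degree_pos:
  assumes "finite_extension f"
  shows "ext_degree f > 0"
proof -
  obtain B where "finite_dimensional_vector_space (ext_scale f) B"
    using finite_extension_vector_space[OF assms] .
  then interpret finite_dimensional_vector_space "ext_scale f" B .
  have "\<not> UNIV \<subseteq> {0 :: 'b}"
    by (metis UNIV_I singletonD subsetD zero_neq_one)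
  then show ?thesis
    unfolding ext_degree_def by (simp only: dim_eq_0 neq0_conv[symmetric] not_False_eq_True)
qed

lemma ext_scale_independent_family_iff_basis:
  assumes "finite_extension f" "finite I" "card I = ext_degree f"
  shows "(\<forall>c. (\<Sum>i\<in>I. f (c i) * w i) = 0 \<longrightarrow> (\<forall>i\<in>I. c i = 0)) \<longleftrightarrow>
    \<not> module.dependent (ext_scale f) (w ` I) \<and> module.span (ext_scale f) (w ` I) = UNIV"
proof -
  obtain B where "finite_dimensional_vector_space (ext_scale f) B"
    using finite_extension_vector_space[OF assms(1)] .
  then interpret finite_dimensional_vector_space "ext_scale f" B .
  show ?thesis
    using independent_family_iff_basis[of I w] assms(2,3)
    by (simp only: ext_degree_def ext_scale_def)
qed

lemma ext_scale_independent_family_spans: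
  assumes "finite_extension f" "finite I" "card I = ext_degree f"
    and indep: "\<And>c. (\<Sum>i\<in>I. f (c i) * w i) = 0 \<Longrightarrow> \<forall>i\<in>I. c i = 0"
  obtains c where "x = (\<Sum>i\<in>I. f (c i) * w i)"
proof -
  interpret vector_space "ext_scale f"
    using assms(1) by (intro vector_space_ext_scale) (simp add: finite_extension_def)
  have inj_w: "inj_on w I"
    by (rule inj_on_independent_family[OF assms(2)]) (simp add: ext_scale_def indep)
  have "x \<in> span (w ` I)"
    using ext_scale_independent_family_iff_basis[OF assms(1-3), of w] indep by blast
  then obtain u where "x = (\<Sum>y\<in>w ` I. ext_scale f (u y) y)"
    by (auto simp: span_finite assms(2))
  then show thesis
    using that[of "\<lambda>i. u (w i)"] by (simp add: sum.reindex[OF inj_w] ext_scale_def)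
qed

lemma generates_normal_basis_iff:
  assumes "finite_extension f" "card (galois_group f) = ext_degree f"
  shows "generates_normal_basis f x \<longleftrightarrow>
    (\<forall>c. (\<Sum>\<sigma>\<in>galois_group f. f (c \<sigma>) * \<sigma> x) = 0 \<longrightarrow> (\<forall>\<sigma>\<in>galois_group f. c \<sigma> = 0))"
  unfolding generates_normal_basis_def
  using ext_degree_pos[OF assms(1)] assms
  by (intro ext_scale_independent_family_iff_basis[symmetric]) (auto intro: card_ge_0_finite)

subsection \<open>Integer-valued valuations\<close>

locale valuation =
  fixes v :: "'n::field \<Rightarrow> int"
  assumes v_mult: "\<And>x y. x \<noteq> 0 \<Longrightarrow> y \<noteq> 0 \<Longrightarrow> v (x * y) = v x + v y"
    and v_add: "\<And>x y. x \<noteq> 0 \<Longrightarrow> y \<noteq> 0 \<Longrightarrow> x + y \<noteq> 0 \<Longrightarrow> min (v x) (v y) \<le> v (x + y)"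
begin

text \<open>Encodes the convention that the valuation of 0 is infinite.\<close>

definition vge :: "int \<Rightarrow> 'n \<Rightarrow> bool" where
  "vge m x \<longleftrightarrow> x = 0 \<or> m \<le> v x"

lemma v_one [simp]: "v 1 = 0"
  using v_mult[of 1 1] by simp

lemma v_minus [simp]: "v (- x) = v x"
proof (cases "x = 0")
  case False
  have "v (-1) + v (-1) = 0"
    using v_mult[of "-1" "-1"] by simp
  then show ?thesis
    using v_mult[of "-1" x] False by simp
qed simp

lemma v_minus_commute: "v (x - y) = v (y - x)"
  using v_minus[of "x - y"] by simp

lemma v_inverse: "x \<noteq> 0 \<Longrightarrow> v (inverse x) = - v x"
  using v_mult[of x "inverse x"] by simp

lemma v_divide: "x \<noteq> 0 \<Longrightarrow> y \<noteq> 0 \<Longrightarrow> v (x / y) = v x - v y"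
  by (simp add: divide_inverse v_mult v_inverse)

lemma v_power: "x \<noteq> 0 \<Longrightarrow> v (x ^ k) = int k * v x"
  by (induction k) (auto simp: v_mult algebra_simps)

lemma v_power_int: "x \<noteq> 0 \<Longrightarrow> v (x powi k) = k * v x"
  by (auto simp: power_int_def v_power v_inverse)

lemma v_prod: "(\<And>i. i \<in> I \<Longrightarrow> a i \<noteq> 0) \<Longrightarrow> v (\<Prod>i\<in>I. a i) = (\<Sum>i\<in>I. v (a i))"
  by (induction I rule: infinite_finite_induct) (auto simp: v_mult)

lemma vge_v [simp]: "vge (v x) x"
  by (simp add: vge_def)

lemma vge_zero [simp]: "vge m 0"
  by (simp add: vge_def)

lemma vge_one [simp]: "vge 0 1"
  by (simp add: vge_def)

lemma vge_mono: "vge m x \<Longrightarrow> k \<le> m \<Longrightarrow> vge k x"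
  by (auto simp: vge_def)

lemma vge_minus [simp]: "vge m (- x) \<longleftrightarrow> vge m x"
  by (simp add: vge_def)

lemma vge_add: "vge m x \<Longrightarrow> vge m y \<Longrightarrow> vge m (x + y)"
  unfolding vge_def using v_add[of x y] by (cases "x = 0"; cases "y = 0"; force)

lemma vge_diff: "vge m x \<Longrightarrow> vge m y \<Longrightarrow> vge m (x - y)"
  using vge_add[of m x "- y"] by simp

lemma vge_mult: "vge m x \<Longrightarrow> vge k y \<Longrightarrow> vge (m + k) (x * y)"
  unfolding vge_def using v_mult[of x y] by (cases "x = 0"; cases "y = 0"; force)

lemma vge_mult_iff: "x \<noteq> 0 \<Longrightarrow> vge m (x * y) \<longleftrightarrow> vge (m - v x) y"
  by (cases "y = 0") (auto simp: vge_def v_mult)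

lemma vge_power: "vge m x \<Longrightarrow> vge (int k * m) (x ^ k)"
  using vge_mult by (induction k) (fastforce simp: algebra_simps)+

lemma vge_sum: "(\<And>i. i \<in> I \<Longrightarrow> vge m (a i)) \<Longrightarrow> vge m (\<Sum>i\<in>I. a i)"
  by (induction I rule: infinite_finite_induct) (auto intro: vge_add)

lemma vge_of_nat: "vge 0 (of_nat k)"
  by (induction k) (auto intro: vge_add)

lemma vge_of_int: "vge 0 (of_int k)"
  by (cases k rule: int_cases2) (auto intro: vge_of_nat)

lemma v_add_eq:
  assumes "x \<noteq> 0" "vge (v x + 1) y"
  shows "x + y \<noteq> 0" "v (x + y) = v x"
proof -
  show nz: "x + y \<noteq> 0"
    using assms by (auto simp: vge_def add_eq_0_iff)
  show "v (x + y) = v x"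
  proof (cases "y = 0")
    case False
    then have "v x < v y"
      using assms by (auto simp: vge_def)
    then show ?thesis
      using v_add[of x y] v_add[of "x + y" "- y"] nz False assms(1) by auto
  qed simp
qed

lemma v_of_nat_coprime:
  assumes residue_char: "vge 1 (of_nat p)" and coprime_k: "coprime k p"
  shows "of_nat k \<noteq> (0::'n)" "v (of_nat k) = 0"
proof -
  obtain a b where "a * int k + b * int p = 1"
    using bezout_int[of "int k" "int p"] coprime_k by (auto simp: coprime_iff_gcd_eq_1)
  then have bezout: "of_int a * of_nat k + of_int b * of_nat p = (1::'n)"
    by (metis of_int_1 of_int_add of_int_mult of_int_of_nat_eq)
  have "\<not> vge 1 (of_nat k)"
  proof
    assume "vge 1 (of_nat k)"
    then have "vge 1 (of_int a * of_nat k + of_int b * of_nat p)"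
      using vge_mult[OF vge_of_int] residue_char by (intro vge_add) force+
    then show False
      unfolding bezout by (simp add: vge_def)
  qed
  then show "of_nat k \<noteq> (0::'n)" "v (of_nat k) = 0"
    using vge_of_nat[of k] by (auto simp: vge_def)
qed

subsection \<open>Dominant terms\<close>

definition dominant :: "('i \<Rightarrow> 'n) \<Rightarrow> 'i set \<Rightarrow> 'i \<Rightarrow> bool" where
  "dominant a I l \<longleftrightarrow> l \<in> I \<and> a l \<noteq> 0 \<and> (\<forall>i\<in>I - {l}. vge (v (a l) + 1) (a i))"

lemma dominant_vge: "dominant a I l \<Longrightarrow> i \<in> I \<Longrightarrow> vge (v (a l)) (a i)"
  by (cases "i = l") (auto simp: dominant_def intro: vge_mono)

lemma v_sum_dominant:
  assumes "finite I" "dominant a I l"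
  shows "(\<Sum>i\<in>I. a i) \<noteq> 0" "v (\<Sum>i\<in>I. a i) = v (a l)"
    "vge (v (a l) + 1) ((\<Sum>i\<in>I. a i) - a l)"
proof -
  have split: "(\<Sum>i\<in>I. a i) = a l + (\<Sum>i\<in>I - {l}. a i)"
    using assms by (simp add: sum.remove dominant_def)
  have rest: "vge (v (a l) + 1) (\<Sum>i\<in>I - {l}. a i)"
    using assms(2) by (intro vge_sum) (simp add: dominant_def)
  show "(\<Sum>i\<in>I. a i) \<noteq> 0" "v (\<Sum>i\<in>I. a i) = v (a l)"
    using v_add_eq[OF _ rest] assms(2) by (auto simp: split dominant_def)
  show "vge (v (a l) + 1) ((\<Sum>i\<in>I. a i) - a l)"
    using rest by (simp add: split)
qed

lemma dominant_exists:
  assumes "finite I" "\<exists>i\<in>I. a i \<noteq> 0" and distinct: "inj_on (\<lambda>i. v (a i)) {i\<in>I. a i \<noteq> 0}"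
  obtains l where "dominant a I l"
proof -
  obtain l where minimal: "is_arg_min (\<lambda>i. v (a i)) (\<lambda>i. i \<in> {i\<in>I. a i \<noteq> 0}) l"
    using ex_is_arg_min_if_finite[of "{i\<in>I. a i \<noteq> 0}"] assms(1,2) by auto
  have "vge (v (a l) + 1) (a i)" if "i \<in> I - {l}" for i
  proof (cases "a i = 0")
    case False
    then have "\<not> v (a i) < v (a l)" "v (a i) \<noteq> v (a l)"
      using that minimal distinct by (auto simp: is_arg_min_def inj_on_def)
    then show ?thesis
      by (simp add: vge_def)
  qed simp
  then show thesis
    using that[of l] minimal by (auto simp: dominant_def is_arg_min_def)
qed

lemma v_root_eisenstein:
  assumes root: "x ^ n = (\<Sum>i<n. c i * x ^ i)"
    and n_pos: "n > 0" and d_pos: "d > 0" and nonzero: "x \<noteq> 0"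
    and coeffs: "\<And>i. i < n \<Longrightarrow> vge d (c i)" and const_coeff: "c 0 \<noteq> 0" "v (c 0) = d"
  shows "int n * v x = d"
proof -
  have v_pos: "v x > 0"
  proof (rule ccontr)
    assume nonpos: "\<not> v x > 0"
    have "vge (int n * v x + 1) (c i * x ^ i)" if "i < n" for i
    proof -
      have "vge (d + int i * v x) (c i * x ^ i)"
        by (intro vge_mult vge_power vge_v coeffs that)
      moreover have "int n * v x \<le> int i * v x"
        using nonpos that by (intro mult_right_mono_neg) auto
      ultimately show ?thesis
        using d_pos by (auto elim: vge_mono)
    qed
    then have "vge (int n * v x + 1) (x ^ n)"
      unfolding root by (intro vge_sum) auto
    then show False
      using nonzero by (simp add: vge_def v_power)
  qed
  have "vge (d + 1) (c i * x ^ i)" if "i < n" "i \<noteq> 0" for i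
  proof -
    have "1 * 1 \<le> int i * v x"
      using that v_pos by (intro mult_mono) auto
    then show ?thesis
      using coeffs[OF that(1)] nonzero by (intro vge_mult) (auto simp: vge_def v_power)
  qed
  then have "dominant (\<lambda>i. c i * x ^ i) {..<n} 0"
    using n_pos const_coeff by (auto simp: dominant_def)
  then have "v (x ^ n) = d"
    unfolding root using v_sum_dominant(2)[of "{..<n}"] const_coeff by force
  then show ?thesis
    using nonzero by (simp add: v_power)
qed

subsection \<open>Differences of powers\<close>

lemma vge_binomial_remainder:
  assumes "vge r e" "0 \<le> r"
  shows "vge (2 * r) ((1 + e) ^ k - 1 - of_nat k * e)"
proof (induction k)
  case (Suc k)
  have "vge (2 * r + 0) (((1 + e) ^ k - 1 - of_nat k * e) * (1 + e))"
    using vge_add[OF vge_one vge_mono[OF assms]] Suc.IH by (intro vge_mult)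
  moreover have "vge (0 + (r + r)) (of_nat k * (e * e))"
    using assms(1) by (intro vge_mult vge_of_nat)
  ultimately have "vge (2 * r) (((1 + e) ^ k - 1 - of_nat k * e) * (1 + e) + of_nat k * (e * e))"
    by (intro vge_add) auto
  then show ?case
    by (simp add: algebra_simps)
qed simp

lemma vge_power_diff_remainder:
  assumes nonzero: "b \<noteq> 0" and diff_bound: "vge (v b + r) (a - b)" "0 \<le> r"
  shows "vge (int k * v b + 2 * r) ((a ^ k - b ^ k) - of_nat k * (b ^ k * ((a - b) / b)))"
proof -
  define e where "e = (a - b) / b"
  have a_eq: "a = b * (1 + e)"
    using nonzero by (simp add: e_def field_simps)
  have "vge r e"
    using diff_bound(1) nonzero vge_mult_iff[of b "v b + r" e] by (simp add: e_def)
  then have "vge (int k * v b + 2 * r) (b ^ k * ((1 + e) ^ k - 1 - of_nat k * e))"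
    using diff_bound(2) by (intro vge_mult vge_power vge_v vge_binomial_remainder)
  also have "b ^ k * ((1 + e) ^ k - 1 - of_nat k * e) = (a ^ k - b ^ k) - of_nat k * (b ^ k * e)"
    by (simp only: a_eq power_mult_distrib) (simp add: algebra_simps)
  finally show ?thesis
    unfolding e_def .
qed

lemma vge_power_diff:
  assumes nonzero: "b \<noteq> 0" and diff_bound: "vge (v b + r) (a - b)" "0 \<le> r"
  shows "vge (int k * v b + r) (a ^ k - b ^ k)"
proof -
  have "vge r ((a - b) / b)"
    using diff_bound(1) nonzero vge_mult_iff[of b "v b + r" "(a - b) / b"] by simp
  then have "vge (0 + (int k * v b + r)) (of_nat k * (b ^ k * ((a - b) / b)))"
    by (intro vge_mult vge_power vge_v vge_of_nat)
  moreover have "vge (int k * v b + r) ((a ^ k - b ^ k) - of_nat k * (b ^ k * ((a - b) / b)))"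
    by (rule vge_mono[OF vge_power_diff_remainder[OF assms]]) (use diff_bound(2) in simp)
  ultimately show ?thesis
    using vge_add by fastforce
qed

lemma v_power_diff:
  assumes nonzero: "b \<noteq> 0" and diff_eq: "a \<noteq> b" "v (a - b) = v b + r" "0 < r"
    and unit: "of_nat k \<noteq> (0::'n)" "v (of_nat k) = 0"
  shows "a ^ k \<noteq> b ^ k" "v (a ^ k - b ^ k) = int k * v b + r"
proof -
  let ?lin = "of_nat k * (b ^ k * ((a - b) / b))"
  have linear_term: "?lin \<noteq> 0" "v ?lin = int k * v b + r"
    using nonzero diff_eq unit by (simp_all add: v_mult v_divide v_power)
  have rest: "vge (v ?lin + 1) ((a ^ k - b ^ k) - ?lin)"
    unfolding linear_term(2)
    by (rule vge_mono[OF vge_power_diff_remainder[OF nonzero, of r]])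
      (use diff_eq in \<open>auto simp: vge_def\<close>)
  have split: "a ^ k - b ^ k = ?lin + ((a ^ k - b ^ k) - ?lin)"
    by simp
  show "a ^ k \<noteq> b ^ k"
    using v_add_eq(1)[OF linear_term(1) rest] unfolding split[symmetric] by simp
  show "v (a ^ k - b ^ k) = int k * v b + r"
    using v_add_eq(2)[OF linear_term(1) rest] unfolding split[symmetric] linear_term(2) .
qed

subsection \<open>Polynomials\<close>

lemma vge_poly:
  assumes "\<And>k. vge m (coeff F k)" "vge 0 x"
  shows "vge m (poly F x)"
  using assms(1)
proof (induction F)
  case (pCons a F)
  have "vge m (coeff F k)" for k
    using pCons.prems[of "Suc k"] by simp
  then have "vge (0 + m) (x * poly F x)"
    using pCons.IH assms(2) by (intro vge_mult) blast+
  then show ?case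
    using pCons.prems[of 0] by (auto intro: vge_add)
qed simp

lemma vge_coeff_prod_linear:
  assumes "finite I" "\<And>i. i \<in> I \<Longrightarrow> vge m (a i)"
  shows "vge (m * (int (card I) - int k)) (coeff (\<Prod>i\<in>I. [:- a i, 1:]) k)"
  using assms
proof (induction I arbitrary: k rule: finite_induct)
  case empty
  then show ?case
    by (simp add: vge_def)
next
  case (insert i I)
  let ?P = "\<Prod>i\<in>I. [:- a i, 1:]"
  have degree_shift: "m + m * (int (card I) - int k) = m * (int (card (insert i I)) - int k)"
    using insert by (simp add: algebra_simps)
  have mult_bound: "vge (m * (int (card (insert i I)) - int k)) (a i * coeff ?P k)"
    unfolding degree_shift[symmetric] using insert by (intro vge_mult) auto
  show ?case
  proof (cases k)
    case 0
    then show ?thesis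
      using insert mult_bound by simp
  next
    case (Suc l)
    have "vge (m * (int (card (insert i I)) - int k)) (coeff ?P l)"
      using insert.IH[of l] insert Suc by auto
    then show ?thesis
      using insert.hyps mult_bound vge_diff Suc by simp
  qed
qed

end

lemma degree_prod_linear: "degree (\<Prod>i\<in>I. [:- a i, 1::'a::idom:]) = card I"
  by (cases "finite I") (simp_all add: degree_prod_eq_sum_degree)

lemma lead_coeff_prod_linear: "lead_coeff (\<Prod>i\<in>I. [:- a i, 1::'a::idom:]) = 1"
  by (simp add: lead_coeff_prod)

subsection \<open>Divided differences\<close>

definition divided_difference :: "'a::field set \<Rightarrow> ('a \<Rightarrow> 'a) \<Rightarrow> 'a" where
  "divided_difference X F = (\<Sum>x\<in>X. F x / (\<Prod>y\<in>X - {x}. x - y))"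

lemma divided_difference_singleton [simp]: "divided_difference {x} F = F x"
  by (simp add: divided_difference_def)

lemma divided_difference_mult_left:
  assumes "finite X" "z \<notin> X"
  shows "divided_difference (insert z X) (\<lambda>x. x * F x)
    = z * divided_difference (insert z X) F + divided_difference X F"
proof -
  have cancel: "F x * (x - z) / (\<Prod>y\<in>insert z X - {x}. x - y) = F x / (\<Prod>y\<in>X - {x}. x - y)"
    if x: "x \<in> X" for x
  proof -
    have "insert z X - {x} = insert z (X - {x})"
      using x assms by auto
    then show ?thesis
      using x assms by auto
  qed
  have "divided_difference (insert z X) (\<lambda>x. x * F x) - z * divided_difference (insert z X) F
      = (\<Sum>x\<in>insert z X. F x * (x - z) / (\<Prod>y\<in>insert z X - {x}. x - y))"
    unfolding divided_difference_def sum_distrib_left sum_subtractf[symmetric]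
    by (intro sum.cong refl) (simp add: algebra_simps diff_divide_distrib)
  also have "\<dots> = divided_difference X F"
    unfolding divided_difference_def using assms cancel by simp
  finally show ?thesis
    by (simp add: algebra_simps)
qed

lemma divided_difference_recurrence:
  assumes "finite X" "w \<notin> X" "z \<notin> X" "w \<noteq> z"
  shows "(w - z) * divided_difference (insert w (insert z X)) F
    = divided_difference (insert w X) F - divided_difference (insert z X) F"
  using divided_difference_mult_left[of "insert z X" w F]
    divided_difference_mult_left[of "insert w X" z F] assms
  by (auto simp: insert_commute algebra_simps)

lemma divided_difference_const_eq_0:
  assumes "finite X" "card X \<ge> 2"
  shows "divided_difference X (\<lambda>_. 1) = 0"
  using assms
proof (induction "card X" arbitrary: X rule: less_induct)
  case less
  then obtain w z Y where X_eq: "X = insert w (insert z Y)" "w \<notin> Y" "z \<notin> Y" "w \<noteq> z" "finite Y"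
    by (auto simp: numeral_2_eq_2 card_le_Suc_iff)
  have "divided_difference (insert w Y) (\<lambda>_. 1) = divided_difference (insert z Y) (\<lambda>_. 1)"
  proof (cases "Y = {}")
    case False
    then have "card (insert u Y) \<ge> 2" "card (insert u Y) < card X" if "u \<notin> Y" for u
      using that X_eq by (simp_all add: Suc_le_eq card_gt_0_iff)
    then show ?thesis
      using less.hyps[of "insert w Y"] less.hyps[of "insert z Y"] X_eq by simp
  qed simp
  then show ?case
    using divided_difference_recurrence[of Y w z "\<lambda>_. 1"] X_eq by simp
qed

lemma divided_difference_power_eq_0:
  assumes "finite X" "Suc m < card X"
  shows "divided_difference X (\<lambda>x. x ^ m) = 0"
  using assms
proof (induction m arbitrary: X)
  case 0
  then show ?case
    by (simp add: divided_difference_const_eq_0)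
next
  case (Suc m)
  then obtain z Y where "X = insert z Y" "z \<notin> Y" "finite Y"
    by (metis Suc_lessD card_le_Suc_iff le_eq_less_or_eq)
  then show ?case
    using Suc by (simp add: divided_difference_mult_left)
qed

lemma divided_difference_power_eq_1:
  assumes "finite X" "card X = Suc m"
  shows "divided_difference X (\<lambda>x. x ^ m) = 1"
  using assms
proof (induction m arbitrary: X)
  case 0
  then show ?case
    by (auto simp: card_1_singleton_iff)
next
  case (Suc m)
  then obtain z Y where X_eq: "X = insert z Y" "z \<notin> Y" "finite Y"
    by (metis card_Suc_eq finite_insert)
  then show ?case
    using Suc by (simp add: divided_difference_mult_left divided_difference_power_eq_0)
qed

context valuation
begin

lemma vge_divided_difference_const:
  assumes "finite X"
  shows "vge (k * (1 - int (card X))) (divided_difference X (\<lambda>_. 1))"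
proof -
  consider "card X = 0" | "card X = 1" | "card X \<ge> 2"
    by linarith
  then show ?thesis
  proof cases
    case 1
    then show ?thesis
      using assms by (simp add: divided_difference_def)
  next
    case 2
    then show ?thesis
      by (auto simp: card_1_singleton_iff)
  next
    case 3
    then show ?thesis
      using assms by (simp add: divided_difference_const_eq_0)
  qed
qed

lemma vge_divided_difference_power:
  assumes "finite X" "\<And>x. x \<in> X \<Longrightarrow> vge k x"
  shows "vge (k * (int m + 1 - int (card X))) (divided_difference X (\<lambda>x. x ^ m))"
  using assms
proof (induction m arbitrary: X)
  case 0
  then show ?case
    using vge_divided_difference_const by simp
next
  case (Suc m)
  show ?case
  proof (cases "X = {}")
    case True
    then show ?thesis
      by (simp add: divided_difference_def)
  next
    case False
    then obtain z Y where X_eq: "X = insert z Y" "z \<notin> Y" "finite Y"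
      using Suc.prems(1) by (metis ex_in_conv finite_insert mk_disjoint_insert)
    let ?m = "k * (int (Suc m) + 1 - int (card X))"
    have "vge (k + k * (int m + 1 - int (card X))) (z * divided_difference X (\<lambda>x. x ^ m))"
      by (intro vge_mult Suc) (use X_eq in simp)
    then have "vge ?m (z * divided_difference X (\<lambda>x. x ^ m))"
      by (simp add: algebra_simps)
    moreover have "vge ?m (divided_difference Y (\<lambda>x. x ^ m))"
      using Suc.IH[of Y] Suc.prems(2) X_eq by (simp add: algebra_simps)
    ultimately show ?thesis
      using X_eq by (simp add: divided_difference_mult_left vge_add)
  qed
qed

end

subsection \<open>Binomial sums\<close>

lemma additive_funpow_eq_binomial_sum:
  fixes s :: "'a::comm_ring_1 \<Rightarrow> 'a"
  assumes "additive s"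
  shows "(s ^^ i) x = (\<Sum>k\<le>i. of_nat (i choose k) * ((\<lambda>y. s y - y) ^^ k) x)"
proof -
  interpret s: additive s by fact
  define a where "a k = ((\<lambda>y. s y - y) ^^ k) x" for k
  have s_of_nat: "s (of_nat m * y) = of_nat m * s y" for m y
    by (induction m) (simp_all add: s.zero s.add algebra_simps)
  have s_a: "s (a k) = a k + a (Suc k)" for k
    by (simp add: a_def)
  have "(s ^^ i) x = (\<Sum>k\<le>i. of_nat (i choose k) * a k)"
  proof (induction i)
    case 0
    then show ?case
      by (simp add: a_def)
  next
    case (Suc i)
    have "(s ^^ Suc i) x
        = (\<Sum>k\<le>i. of_nat (i choose k) * a k) + (\<Sum>k\<le>i. of_nat (i choose k) * a (Suc k))"
      using Suc by (simp add: s.sum s_of_nat s_a distrib_left sum.distrib)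
    also have "(\<Sum>k\<le>i. of_nat (i choose k) * a k) = (\<Sum>k\<le>Suc i. of_nat (i choose k) * a k)"
      by (simp add: binomial_eq_0)
    also have "\<dots> = a 0 + (\<Sum>k\<le>i. of_nat (i choose Suc k) * a (Suc k))"
      by (subst sum.atMost_Suc_shift) simp
    also have
      "\<dots> + (\<Sum>k\<le>i. of_nat (i choose k) * a (Suc k)) = (\<Sum>k\<le>Suc i. of_nat (Suc i choose k) * a k)"
      by (subst sum.atMost_Suc_shift) (simp add: sum.distrib algebra_simps)
    finally show ?case .
  qed
  then show ?thesis
    by (simp add: a_def)
qed

lemma binomial_sums_eq_0:
  fixes c :: "nat \<Rightarrow> 'a::comm_semiring_1"
  assumes "\<And>k. k < n \<Longrightarrow> (\<Sum>i<n. c i * of_nat (i choose k)) = 0" "i < n"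
  shows "c i = 0"
  using assms
proof (induction n)
  case (Suc n)
  have "c n = 0"
    using Suc.prems(1)[of n] by (simp add: binomial_eq_0)
  then have "(\<Sum>i<n. c i * of_nat (i choose k)) = 0" if "k < n" for k
    using Suc.prems(1)[of k] that by simp
  then show ?case
    using Suc.IH Suc.prems(2) \<open>c n = 0\<close> by (cases "i = n") auto
qed simp

subsection \<open>Elementary abelian groups\<close>

lemma (in group) bij_betw_subgroup_translate:
  assumes "subgroup H G" "s \<in> H"
  shows "bij_betw (\<lambda>h. s \<otimes> h) H H"
proof (rule bij_betw_imageI)
  have s_carrier: "s \<in> carrier G"
    using assms by (rule subgroup.mem_carrier)
  show "inj_on (\<lambda>h. s \<otimes> h) H"
    using inj_on_subset[OF inj_on_cmult[OF s_carrier] subgroup.subset[OF assms(1)]] .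
  show "(\<lambda>h. s \<otimes> h) ` H = H"
    using coset_join3[OF s_carrier assms] by (auto simp: l_coset_def)
qed

lemma (in group) nat_pow_mem_subgroup:
  assumes "subgroup H G" "h \<in> H"
  shows "h [^] (k :: nat) \<in> H"
  using subgroup_int_pow_closed[OF assms, of "int k"] by (simp add: int_pow_int)

lemma (in group) mult_mem_subgroup_iff:
  assumes "subgroup H G" "h \<in> H" "x \<in> carrier G"
  shows "x \<otimes> h \<in> H \<longleftrightarrow> x \<in> H"
proof
  have h_carrier: "h \<in> carrier G"
    using assms by (intro subgroup.mem_carrier)
  assume "x \<otimes> h \<in> H"
  then have "(x \<otimes> h) \<otimes> inv h \<in> H"
    using subgroup.m_closed[OF assms(1) _ subgroup.m_inv_closed[OF assms(1,2)]] by blast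
  also have "(x \<otimes> h) \<otimes> inv h = x"
    using h_carrier assms(3) by (simp add: m_assoc)
  finally show "x \<in> H" .
qed (use assms in \<open>auto intro: subgroup.m_closed\<close>)

locale elementary_abelian_group = comm_group G
  for G (structure) +
  fixes p :: nat
  assumes prime_p: "prime p"
    and finite_carrier: "finite (carrier G)"
    and pow_p: "x \<in> carrier G \<Longrightarrow> x [^] p = \<one>"
begin

lemma int_pow_eq_one:
  assumes "x \<in> carrier G" "int p dvd i"
  shows "x [^] i = \<one>"
proof -
  obtain k where "i = int p * k"
    using assms(2) by (elim dvdE)
  then have "x [^] i = (x [^] int p) [^] k"
    using assms(1) by (simp add: int_pow_pow)
  then show ?thesis
    using assms(1) by (simp add: int_pow_int pow_p)
qed

lemma int_pow_cong:
  assumes "x \<in> carrier G" "[i = k] (mod int p)"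
  shows "x [^] i = x [^] k"
proof -
  have "x [^] i = x [^] (i - k) \<otimes> x [^] k"
    using int_pow_mult[OF assms(1), of "i - k" k] by simp
  then show ?thesis
    using assms int_pow_eq_one by (simp add: cong_iff_dvd_diff)
qed

lemma nat_pow_cong:
  assumes "x \<in> carrier G" "[i = k] (mod p)"
  shows "x [^] i = x [^] k"
  using int_pow_cong[OF assms(1), of "int i" "int k"] assms(2)
  by (simp add: cong_int_iff int_pow_int)

lemma int_pow_mem_subgroup_iff:
  assumes subgroup_H: "subgroup H G" and outside: "s \<in> carrier G" "s \<notin> H"
  shows "s [^] (i :: int) \<in> H \<longleftrightarrow> int p dvd i"
proof
  assume pow_mem: "s [^] i \<in> H"
  show "int p dvd i"
  proof (rule ccontr)
    assume "\<not> int p dvd i"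
    then have "coprime i (int p)"
      using prime_imp_coprime[of "int p" i] prime_p by (simp add: coprime_commute)
    then obtain k where "[i * k = 1] (mod int p)"
      using cong_solve_coprime_int by blast
    then have "s = (s [^] i) [^] k"
      using int_pow_cong[OF outside(1)] outside(1) int_pow_pow[OF outside(1), of i k] by force
    then show False
      using subgroup_int_pow_closed[OF subgroup_H pow_mem, of k] outside(2) by simp
  qed
next
  assume "int p dvd i"
  then show "s [^] i \<in> H"
    using int_pow_eq_one[OF outside(1)] subgroup.one_closed[OF subgroup_H] by simp
qed

definition adjoin :: "'a set \<Rightarrow> 'a \<Rightarrow> 'a set" where
  "adjoin H s = generate G {s} <#> H"

lemma
  assumes subgroup_H: "subgroup H G" and s_carrier: "s \<in> carrier G"
  shows subgroup_adjoin: "subgroup (adjoin H s) G"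
    and subset_adjoin: "H \<subseteq> adjoin H s"
    and mem_adjoin: "s \<in> adjoin H s"
proof -
  have subgroup_generate: "subgroup (generate G {s}) G"
    using s_carrier by (intro generate_is_subgroup) simp
  show "subgroup (adjoin H s) G"
    unfolding adjoin_def by (rule mult_subgroups[OF subgroup_generate subgroup_H])
  show "H \<subseteq> adjoin H s"
    using subgroup.one_closed[OF subgroup_generate] subgroup.mem_carrier[OF subgroup_H]
    by (force simp: adjoin_def set_mult_def)
  have "s \<otimes> \<one> \<in> adjoin H s"
    using generate.incl[of s "{s}" G] subgroup.one_closed[OF subgroup_H]
    unfolding adjoin_def set_mult_def by blast
  then show "s \<in> adjoin H s"
    using s_carrier by simp
qed

lemma generate_eq_nat_pow_image:
  assumes "s \<in> carrier G"
  shows "generate G {s} = (\<lambda>i :: nat. s [^] i) ` {..<p}"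
proof (intro equalityI subsetI)
  fix x assume "x \<in> generate G {s}"
  then obtain k :: int where x_eq: "x = s [^] k"
    by (auto simp: generate_pow[OF assms])
  define i where "i = nat (k mod int p)"
  have "int p > 0"
    using prime_gt_0_nat[OF prime_p] by simp
  then have "i < p" "[k = int i] (mod int p)"
    by (simp_all add: i_def nat_less_iff cong_def)
  then show "x \<in> (\<lambda>i. s [^] i) ` {..<p}"
    using int_pow_cong[OF assms, of k "int i"] by (auto simp: x_eq int_pow_int)
next
  fix x assume "x \<in> (\<lambda>i :: nat. s [^] i) ` {..<p}"
  then show "x \<in> generate G {s}"
    by (auto simp: generate_pow[OF assms] simp flip: int_pow_int)
qed

lemma adjoin_eq_image:
  assumes "s \<in> carrier G"
  shows "adjoin H s = (\<lambda>(i, h). s [^] (i :: nat) \<otimes> h) ` ({..<p} \<times> H)"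
  by (auto simp: adjoin_def set_mult_def generate_eq_nat_pow_image[OF assms])

lemma bij_betw_adjoin:
  assumes subgroup_H: "subgroup H G" and outside: "s \<in> carrier G" "s \<notin> H"
  shows "bij_betw (\<lambda>(i, h). s [^] (i :: nat) \<otimes> h) ({..<p} \<times> H) (adjoin H s)"
proof (rule bij_betw_imageI)
  show "inj_on (\<lambda>(i, h). s [^] (i :: nat) \<otimes> h) ({..<p} \<times> H)"
  proof (rule inj_onI, clarify)
    fix i h k h' assume less: "i < p" "k < p" and mem_H: "h \<in> H" "h' \<in> H"
      and eq: "s [^] i \<otimes> h = s [^] k \<otimes> h'"
    note carriers = subgroup.mem_carrier[OF subgroup_H] outside(1)
    have "h' \<otimes> inv h = inv (s [^] k) \<otimes> (s [^] i \<otimes> h) \<otimes> inv h"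
      unfolding eq using mem_H carriers by (simp add: m_assoc[symmetric])
    also have "\<dots> = inv (s [^] k) \<otimes> s [^] i"
      using mem_H carriers by (simp add: m_assoc)
    also have "\<dots> = s [^] i \<otimes> inv (s [^] k)"
      using outside(1) by (simp add: m_comm)
    also have "\<dots> = s [^] (int i - int k)"
      using outside(1) by (simp add: int_pow_diff int_pow_int)
    finally have "s [^] (int i - int k) \<in> H"
      using mem_H subgroup.m_closed[OF subgroup_H] subgroup.m_inv_closed[OF subgroup_H] by metis
    then have "int p dvd int i - int k"
      using int_pow_mem_subgroup_iff[OF subgroup_H outside] by simp
    then have "i = k"
      using less by (simp add: mod_eq_dvd_iff[symmetric])
    then show "i = k \<and> h = h'"
      using eq mem_H carriers by simp
  qed
qed (rule adjoin_eq_image[OF outside(1), symmetric])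

lemma sum_adjoin:
  assumes "subgroup H G" "s \<in> carrier G" "s \<notin> H"
  shows "(\<Sum>g\<in>adjoin H s. F g) = (\<Sum>i<p. \<Sum>h\<in>H. F (s [^] i \<otimes> h))"
  using sum.reindex_bij_betw[OF bij_betw_adjoin[OF assms], of F]
  by (simp add: sum.cartesian_product split_def)

lemma pow_mult_notin_adjoin:
  assumes "subgroup H G" "s \<in> carrier G" "t \<in> carrier G" "t \<notin> adjoin H s"
  shows "s [^] (i :: nat) \<otimes> t \<notin> adjoin H s"
  using assms mult_mem_subgroup_iff[OF subgroup_adjoin, of H s "s [^] i" t]
    nat_pow_mem_subgroup[OF subgroup_adjoin mem_adjoin] by (simp add: m_comm)

lemma adjoin_exchange:
  assumes subgroup_H: "subgroup H G" and outside: "s \<in> carrier G" "s \<notin> H"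
    and t_carrier: "t \<in> carrier G" and mem: "s \<in> adjoin H t"
  shows "t \<in> adjoin H s"
proof (rule ccontr)
  assume t_notin: "t \<notin> adjoin H s"
  obtain i h where i_less: "i < p" and h_mem: "h \<in> H" and s_eq: "s = t [^] (i :: nat) \<otimes> h"
    using mem by (auto simp: adjoin_eq_image[OF t_carrier])
  note carriers = subgroup.mem_carrier[OF subgroup_H h_mem] outside(1) t_carrier
  note adjoin_facts = subgroup_adjoin[OF subgroup_H outside(1)]
    subset_adjoin[OF subgroup_H outside(1)] mem_adjoin[OF subgroup_H outside(1)]
  have "t [^] int i = s \<otimes> inv h"
    using s_eq carriers by (simp add: int_pow_int inv_solve_right)
  also have "\<dots> \<in> adjoin H s"
    using h_mem adjoin_facts by (blast intro: subgroup.m_closed subgroup.m_inv_closed)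
  finally have "int p dvd int i"
    using int_pow_mem_subgroup_iff[OF adjoin_facts(1) t_carrier t_notin] by simp
  then show False
    using i_less s_eq h_mem outside(2) carriers by (cases "i = 0") (auto dest: dvd_imp_le)
qed

end

subsection \<open>Sums over cosets\<close>

definition (in group) coset_sum :: "('a \<Rightarrow> 'c::comm_monoid_add) \<Rightarrow> 'a set \<Rightarrow> 'a \<Rightarrow> 'c" where
  "coset_sum F H g = (\<Sum>h\<in>H. F (g \<otimes> h))"

lemma (in group) coset_sum_mult_right:
  assumes "subgroup H G" "g \<in> carrier G" "s \<in> H"
  shows "coset_sum F H (g \<otimes> s) = coset_sum F H g"
  using sum.reindex_bij_betw[OF bij_betw_subgroup_translate[OF assms(1,3)], of "\<lambda>h. F (g \<otimes> h)"]
    assms subgroup.mem_carrier[OF assms(1)]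
  by (simp add: coset_sum_def m_assoc cong: sum.cong)

lemma bij_betw_mult_mod:
  fixes k n :: nat
  assumes "coprime k n" "n > 0"
  shows "bij_betw (\<lambda>i. i * k mod n) {..<n} {..<n}"
proof -
  have "inj_on (\<lambda>i. i * k mod n) {..<n}"
    using assms(1) by (auto simp: inj_on_def cong_def[symmetric] cong_mult_rcancel_nat
        cong_less_modulus_unique_nat)
  moreover have "(\<lambda>i. i * k mod n) ` {..<n} \<subseteq> {..<n}"
    using assms(2) by auto
  ultimately show ?thesis
    by (simp add: bij_betw_def endo_inj_surj)
qed

context elementary_abelian_group
begin

lemma coset_sum_adjoin:
  assumes "subgroup H G" "s \<in> carrier G" "s \<notin> H" "g \<in> carrier G"
  shows "coset_sum F (adjoin H s) g = (\<Sum>i<p. coset_sum F H (g \<otimes> s [^] i))"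
  using assms subgroup.mem_carrier[OF assms(1)]
  by (simp add: coset_sum_def sum_adjoin m_assoc cong: sum.cong)

lemma sum_coset_sum_multiples:
  assumes subgroup_H: "subgroup H G" and outside: "s \<in> carrier G" "s \<notin> H"
    and g_carrier: "g \<in> carrier G" and not_dvd: "\<not> p dvd k"
  shows "(\<Sum>i<p. coset_sum F H (g \<otimes> s [^] (i * k))) = coset_sum F (adjoin H s) g"
proof -
  have "bij_betw (\<lambda>i. i * k mod p) {..<p} {..<p}"
    using prime_imp_coprime[OF prime_p not_dvd] prime_gt_0_nat[OF prime_p]
    by (intro bij_betw_mult_mod) (simp_all add: coprime_commute)
  note reindex = sum.reindex_bij_betw[OF this, of "\<lambda>i. coset_sum F H (g \<otimes> s [^] i)"]
  have "(\<Sum>i<p. coset_sum F H (g \<otimes> s [^] (i * k))) = (\<Sum>i<p. coset_sum F H (g \<otimes> s [^] (i * k mod p)))"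
    by (intro sum.cong refl arg_cong[where f = "\<lambda>x. coset_sum F H (g \<otimes> x)"] nat_pow_cong outside(1))
      (simp add: cong_def)
  also have "\<dots> = (\<Sum>i<p. coset_sum F H (g \<otimes> s [^] i))"
    by (rule reindex)
  also have "\<dots> = coset_sum F (adjoin H s) g"
    by (rule coset_sum_adjoin[OF subgroup_H outside g_carrier, symmetric])
  finally show ?thesis .
qed

text \<open>
  The cosets of the \<open>p\<close> overgroups of \<open>H\<close> generated by the elements \<open>s\<^sup>i t\<close> cover the coset of \<open>H\<close>
  itself \<open>p\<close> times and the nontrivial cosets of \<open>adjoin H s\<close> in \<open>adjoin (adjoin H s) t\<close> once.
  This takes the place of the decomposition of the group ring by characters.
\<close>

lemma sum_coset_sum_adjoin:
  fixes F :: "'a \<Rightarrow> 'c::semiring_1"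
  assumes subgroup_H: "subgroup H G" and s_outside: "s \<in> carrier G" "s \<notin> H"
    and t_outside: "t \<in> carrier G" "t \<notin> adjoin H s" and g_carrier: "g \<in> carrier G"
  shows "(\<Sum>i<p. coset_sum F (adjoin H (s [^] i \<otimes> t)) g)
    = of_nat p * coset_sum F H g + (\<Sum>k=1..<p. coset_sum F (adjoin H s) (g \<otimes> t [^] k))"
proof -
  have st_outside: "s [^] i \<otimes> t \<in> carrier G" "s [^] i \<otimes> t \<notin> H" for i :: nat
    using pow_mult_notin_adjoin[OF subgroup_H s_outside(1) t_outside]
      subset_adjoin[OF subgroup_H s_outside(1)] s_outside(1) t_outside(1) by auto
  have pow_eq: "g \<otimes> (s [^] i \<otimes> t) [^] k = (g \<otimes> t [^] k) \<otimes> s [^] (i * k)" for i k :: nat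
    using s_outside(1) t_outside(1) g_carrier by (simp add: nat_pow_distrib nat_pow_pow m_ac)
  have nontrivial: "(\<Sum>i<p. coset_sum F H ((g \<otimes> t [^] k) \<otimes> s [^] (i * k)))
      = coset_sum F (adjoin H s) (g \<otimes> t [^] k)" if "k \<in> {1..<p}" for k
    using that g_carrier t_outside(1)
    by (intro sum_coset_sum_multiples[OF subgroup_H s_outside]) (auto dest: dvd_imp_le)
  have "(\<Sum>i<p. coset_sum F (adjoin H (s [^] i \<otimes> t)) g)
      = (\<Sum>i<p. \<Sum>k<p. coset_sum F H ((g \<otimes> t [^] k) \<otimes> s [^] (i * k)))"
    by (simp only: coset_sum_adjoin[OF subgroup_H st_outside g_carrier] pow_eq)
  also have "\<dots> = (\<Sum>k<p. \<Sum>i<p. coset_sum F H ((g \<otimes> t [^] k) \<otimes> s [^] (i * k)))"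
    by (rule sum.swap)
  also have "\<dots> = of_nat p * coset_sum F H g
      + (\<Sum>k=1..<p. \<Sum>i<p. coset_sum F H ((g \<otimes> t [^] k) \<otimes> s [^] (i * k)))"
    using prime_gt_0_nat[OF prime_p] g_carrier
    by (subst (1) lessThan_atLeast0) (simp add: sum.atLeast_Suc_lessThan)
  finally show ?thesis
    by (simp only: nontrivial cong: sum.cong)
qed

lemma adjoin_eq_carrier_if_coset_sum_maximal:
  fixes F :: "'a \<Rightarrow> 'c::{idom,ring_char_0}"
  assumes H_nonzero: "subgroup H G" "g \<in> carrier G" "coset_sum F H g \<noteq> 0"
    and maximal: "\<And>K g. subgroup K G \<Longrightarrow> H \<subset> K \<Longrightarrow> K \<noteq> carrier G \<Longrightarrow> g \<in> carrier G \<Longrightarrow>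
      coset_sum F K g = 0"
    and s_outside: "s \<in> carrier G" "s \<notin> H"
  shows "adjoin H s = carrier G"
proof (rule ccontr)
  assume proper: "adjoin H s \<noteq> carrier G"
  then obtain t where t_outside: "t \<in> carrier G" "t \<notin> adjoin H s"
    using subgroup.subset[OF subgroup_adjoin[OF H_nonzero(1) s_outside(1)]] by blast
  have overgroup_zero: "coset_sum F (adjoin H u) g = 0"
    if "u \<in> carrier G" "u \<notin> H" "adjoin H u \<noteq> carrier G" "g \<in> carrier G" for u g
    using that subgroup_adjoin[OF H_nonzero(1)] subset_adjoin[OF H_nonzero(1)]
      mem_adjoin[OF H_nonzero(1)]
    by (intro maximal) auto
  have "coset_sum F (adjoin H (s [^] i \<otimes> t)) g = 0" for i :: nat
  proof -
    let ?u = "s [^] i \<otimes> t"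
    have u_outside: "?u \<in> carrier G" "?u \<notin> adjoin H s"
      using pow_mult_notin_adjoin[OF H_nonzero(1) s_outside(1) t_outside] s_outside(1) t_outside(1)
      by simp_all
    then have "s \<notin> adjoin H ?u"
      using adjoin_exchange[OF H_nonzero(1) s_outside u_outside(1)] by blast
    then show ?thesis
      using overgroup_zero[of ?u] u_outside subset_adjoin[OF H_nonzero(1) s_outside(1)] s_outside(1)
        H_nonzero(2) by blast
  qed
  then have "of_nat p * coset_sum F H g = 0"
    using sum_coset_sum_adjoin[OF H_nonzero(1) s_outside t_outside H_nonzero(2), of F]
      overgroup_zero[OF s_outside proper] H_nonzero(2) t_outside(1) by simp
  then show False
    using H_nonzero(3) prime_gt_0_nat[OF prime_p] by simp
qed

lemma coset_sum_nonzero_hyperplane: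
  fixes F :: "'a \<Rightarrow> 'c::{idom,ring_char_0}"
  assumes "carrier G \<noteq> {\<one>}" "g\<^sub>0 \<in> carrier G" "F g\<^sub>0 \<noteq> 0"
  obtains H g where "subgroup H G" "H \<noteq> carrier G"
    "\<And>s. s \<in> carrier G \<Longrightarrow> s \<notin> H \<Longrightarrow> adjoin H s = carrier G"
    "g \<in> carrier G" "coset_sum F H g \<noteq> 0"
proof -
  define good where
    "good = {H. subgroup H G \<and> H \<noteq> carrier G \<and> (\<exists>g\<in>carrier G. coset_sum F H g \<noteq> 0)}"
  have "{\<one>} \<in> good"
    using assms triv_subgroup by (auto simp: good_def coset_sum_def)
  moreover have "finite good"
    using finite_carrier subgroup.subset
    by (intro finite_subset[of good "Pow (carrier G)"]) (auto simp: good_def)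
  ultimately obtain H where good_H: "H \<in> good" and maximal: "\<And>K. K \<in> good \<Longrightarrow> H \<subseteq> K \<Longrightarrow> H = K"
    using finite_has_maximal[of good] by blast
  then obtain g where nonzero: "subgroup H G" "H \<noteq> carrier G" "g \<in> carrier G" "coset_sum F H g \<noteq> 0"
    by (auto simp: good_def)
  have "adjoin H s = carrier G" if "s \<in> carrier G" "s \<notin> H" for s
    by (rule adjoin_eq_carrier_if_coset_sum_maximal[OF nonzero(1,3,4) _ that])
      (use maximal in \<open>auto simp: good_def\<close>)
  then show thesis
    using that nonzero by blast
qed

end

subsection \<open>Totally ramified extensions\<close>

locale totally_ramified_extension = valuation v
  for v :: "'n::field \<Rightarrow> int" +
  fixes f :: "'k::field \<Rightarrow> 'n" and \<pi> :: 'n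
  assumes ext: "finite_extension f"
    and ramified: "totally_ramified f v"
    and prime_pi: "prime_element v \<pi>"
begin

abbreviation q :: nat where
  "q \<equiv> ext_degree f"

sublocale base: field_hom f
  using ext by (simp add: finite_extension_def flip: field_embedding_iff)

lemma pi_nonzero [simp]: "\<pi> \<noteq> 0"
  and v_pi [simp]: "v \<pi> = 1"
  using prime_pi by (simp_all add: prime_element_def)

lemma vge_pi [simp]: "vge 1 \<pi>"
  by (simp add: vge_def)

lemma v_pi_power: "v (\<pi> ^ i) = int i"
  by (simp add: v_power)

lemma q_pos: "q > 0"
  by (rule ext_degree_pos[OF ext])

lemma dvd_v_base: "c \<noteq> 0 \<Longrightarrow> int q dvd v (f c)"
  using ramified base.eq_0_iff[of c] unfolding totally_ramified_def by blast

lemma v_base_surj: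
  assumes "int q dvd m"
  obtains c where "c \<noteq> 0" "v (f c) = m"
proof -
  have "m \<in> v ` (range f - {0})"
    using assms ramified by (simp add: totally_ramified_def)
  then obtain c where "v (f c) = m" "f c \<noteq> 0"
    by (auto simp del: base.eq_0_iff)
  then show thesis
    using that[of c] by simp
qed

lemma incongruent_combination_dominant:
  assumes "finite I" and nonzero: "\<And>i. i \<in> I \<Longrightarrow> w i \<noteq> 0"
    and incongruent: "inj_on (\<lambda>i. v (w i) mod int q) I" and nontrivial: "\<exists>i\<in>I. c i \<noteq> 0"
  obtains l where "dominant (\<lambda>i. f (c i) * w i) I l"
proof (rule dominant_exists[of I "\<lambda>i. f (c i) * w i"])
  show "\<exists>i\<in>I. f (c i) * w i \<noteq> 0"
    using nontrivial nonzero by auto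
  show "inj_on (\<lambda>i. v (f (c i) * w i)) {i\<in>I. f (c i) * w i \<noteq> 0}"
  proof (rule inj_onI)
    fix i k assume terms: "i \<in> {i\<in>I. f (c i) * w i \<noteq> 0}" "k \<in> {i\<in>I. f (c i) * w i \<noteq> 0}"
      and eq: "v (f (c i) * w i) = v (f (c k) * w k)"
    then have "v (w i) - v (w k) = v (f (c k)) - v (f (c i))"
      by (simp add: v_mult)
    moreover have "int q dvd v (f (c k)) - v (f (c i))"
      using terms by (intro dvd_diff dvd_v_base) auto
    ultimately have "v (w i) mod int q = v (w k) mod int q"
      by (simp add: mod_eq_dvd_iff)
    then show "i = k"
      using terms incongruent by (auto simp: inj_on_def)
  qed
qed (use assms(1) that in auto)

lemma incongruent_combination_eq_0:
  assumes "finite I" "\<And>i. i \<in> I \<Longrightarrow> w i \<noteq> 0" "inj_on (\<lambda>i. v (w i) mod int q) I"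
    and "(\<Sum>i\<in>I. f (c i) * w i) = 0"
  shows "\<forall>i\<in>I. c i = 0"
  using incongruent_combination_dominant[of I w c] v_sum_dominant(1)[of I] assms by blast

lemma inj_on_v_pi_power_mod: "inj_on (\<lambda>i. v (\<pi> ^ i) mod int q) {..<q}"
  by (auto simp: inj_on_def v_pi_power)

lemma pi_expansion:
  obtains c where "x = (\<Sum>i<q. f (c i) * \<pi> ^ i)"
  using ext_scale_independent_family_spans[OF ext, of "{..<q}" "\<lambda>i. \<pi> ^ i" x]
    incongruent_combination_eq_0[of "{..<q}" "\<lambda>i. \<pi> ^ i"] inj_on_v_pi_power_mod by auto

lemma pi_expansion_dominant:
  assumes "x \<noteq> 0"
  obtains c l where "x = (\<Sum>i<q. f (c i) * \<pi> ^ i)" "dominant (\<lambda>i. f (c i) * \<pi> ^ i) {..<q} l"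
proof -
  obtain c where expansion: "x = (\<Sum>i<q. f (c i) * \<pi> ^ i)"
    using pi_expansion .
  have "\<exists>i\<in>{..<q}. c i \<noteq> 0"
    using assms by (rule contrapos_np) (simp add: expansion base.zero)
  then show thesis
    using that[OF expansion] incongruent_combination_dominant[of "{..<q}" "\<lambda>i. \<pi> ^ i" c]
      inj_on_v_pi_power_mod by auto
qed

lemma pi_expansion_vge:
  assumes "vge m x"
  obtains c where "x = (\<Sum>i<q. f (c i) * \<pi> ^ i)" "\<And>i. i < q \<Longrightarrow> vge m (f (c i) * \<pi> ^ i)"
proof (cases "x = 0")
  case True
  then show thesis
    using that[of "\<lambda>_. 0"] by (simp add: base.zero)
next
  case False
  then obtain c l where expansion: "x = (\<Sum>i<q. f (c i) * \<pi> ^ i)"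
    and dominant_l: "dominant (\<lambda>i. f (c i) * \<pi> ^ i) {..<q} l"
    using pi_expansion_dominant by blast
  have "vge m (f (c i) * \<pi> ^ i)" if "i < q" for i
    using vge_mono[OF dominant_vge[OF dominant_l]] v_sum_dominant(2)[OF _ dominant_l] assms False
      that
    by (simp add: expansion vge_def)
  then show thesis
    using that[OF expansion] by blast
qed

lemma residue_representative:
  assumes "x \<noteq> 0" "v x = 0"
  obtains c where "c \<noteq> 0" "v (f c) = 0" "vge 1 (x - f c)"
proof -
  obtain c l where expansion: "x = (\<Sum>i<q. f (c i) * \<pi> ^ i)"
    and dominant_l: "dominant (\<lambda>i. f (c i) * \<pi> ^ i) {..<q} l"
    using pi_expansion_dominant[OF assms(1)] .
  have leading: "c l \<noteq> 0" "l < q"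
    using dominant_l by (auto simp: dominant_def)
  have v_leading: "v (f (c l)) + int l = 0"
    using v_sum_dominant(2)[OF _ dominant_l] assms(2) leading
    by (simp add: expansion[symmetric] v_mult v_pi_power)
  then have "int q dvd int l"
    using dvd_v_base[OF leading(1)] by (metis dvd_0_right dvd_add_right_iff)
  then have "l = 0"
    using leading(2) by (auto dest: dvd_imp_le)
  then show thesis
    using that[OF leading(1)] v_leading v_sum_dominant(3)[OF _ dominant_l]
    by (simp add: expansion[symmetric])
qed

text \<open>
  The prime element is the root of an Eisenstein polynomial over the base field, which forces its
  conjugates to be prime elements too. So the valuation is Galois invariant without appeal to
  completeness.
\<close>

lemma pi_eisenstein:
  obtains c where "\<pi> ^ q = (\<Sum>i<q. f (c i) * \<pi> ^ i)"
    "\<And>i. i < q \<Longrightarrow> vge (int q) (f (c i))" "c 0 \<noteq> 0" "v (f (c 0)) = int q"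
proof -
  obtain c l where expansion: "\<pi> ^ q = (\<Sum>i<q. f (c i) * \<pi> ^ i)"
    and dominant_l: "dominant (\<lambda>i. f (c i) * \<pi> ^ i) {..<q} l"
    using pi_expansion_dominant[of "\<pi> ^ q"] by auto
  have leading: "c l \<noteq> 0" "l < q"
    using dominant_l by (auto simp: dominant_def)
  have v_leading: "v (f (c l)) + int l = int q"
    using v_sum_dominant(2)[OF _ dominant_l] leading(1)
    by (simp add: expansion[symmetric] v_mult v_pi_power)
  then have "int q dvd int l"
    using dvd_v_base[OF leading(1)] by (metis dvd_add_right_iff dvd_refl)
  then have l_eq_0: "l = 0"
    using leading(2) by (auto dest: dvd_imp_le)
  have "vge (int q) (f (c i))" if i_less: "i < q" for i
  proof (cases "c i = 0")
    case False
    then have "int q \<le> v (f (c i)) + int i"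
      using dominant_vge[OF dominant_l, of i] i_less v_leading leading(1)
      by (simp add: vge_def v_mult v_pi_power)
    then have "0 < v (f (c i))"
      using i_less by simp
    then show ?thesis
      using dvd_v_base[OF False] by (simp add: vge_def zdvd_imp_le)
  qed (simp add: base.zero)
  then show thesis
    using that[OF expansion] leading(1) v_leading l_eq_0 by simp
qed

context
  fixes s :: "'n \<Rightarrow> 'n"
  assumes hom: "field_hom s" and fixes_base: "\<And>c. s (f c) = f c"
begin

interpretation s: field_hom s
  by (rule hom)

lemma v_conjugate_pi: "v (s \<pi>) = 1"
proof -
  obtain c where root: "\<pi> ^ q = (\<Sum>i<q. f (c i) * \<pi> ^ i)"
    and eisenstein: "\<And>i. i < q \<Longrightarrow> vge (int q) (f (c i))" "c 0 \<noteq> 0" "v (f (c 0)) = int q"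
    using pi_eisenstein by blast
  have "s \<pi> ^ q = (\<Sum>i<q. f (c i) * s \<pi> ^ i)"
    using arg_cong[OF root, of s] by (simp add: s.homs fixes_base)
  then have "int q * v (s \<pi>) = int q"
    by (rule v_root_eisenstein) (use eisenstein q_pos in auto)
  then show ?thesis
    using q_pos by simp
qed

lemma v_conjugate: "v (s x) = v x"
proof (cases "x = 0")
  case True
  then show ?thesis
    by (simp add: s.zero)
next
  case False
  then obtain c l where expansion: "x = (\<Sum>i<q. f (c i) * \<pi> ^ i)"
    and dominant_l: "dominant (\<lambda>i. f (c i) * \<pi> ^ i) {..<q} l"
    using pi_expansion_dominant by blast
  have v_term: "v (f (c i) * s \<pi> ^ i) = v (f (c i) * \<pi> ^ i)" for i
    using v_conjugate_pi by (cases "c i = 0") (simp_all add: base.zero v_mult v_power)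
  have "dominant (\<lambda>i. f (c i) * s \<pi> ^ i) {..<q} l"
    using dominant_l by (auto simp: dominant_def v_term vge_def)
  from v_sum_dominant(2)[OF _ this] v_sum_dominant(2)[OF _ dominant_l]
  have "v (\<Sum>i<q. f (c i) * s \<pi> ^ i) = v (\<Sum>i<q. f (c i) * \<pi> ^ i)"
    by (simp add: v_term)
  then show ?thesis
    by (simp add: expansion s.homs fixes_base)
qed

end

end

subsection \<open>Galois groups\<close>

definition Gal :: "('k::field \<Rightarrow> 'n::field) \<Rightarrow> ('n \<Rightarrow> 'n) monoid" where
  "Gal f = \<lparr>carrier = galois_group f, monoid.mult = (\<circ>), one = id\<rparr>"

lemma carrier_Gal [simp]: "carrier (Gal f) = galois_group f"
  and mult_Gal [simp]: "s \<otimes>\<^bsub>Gal f\<^esub> t = s \<circ> t"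
  and one_Gal [simp]: "\<one>\<^bsub>Gal f\<^esub> = id"
  by (simp_all add: Gal_def)

lemma nat_pow_Gal [simp]: "s [^]\<^bsub>Gal f\<^esub> (k :: nat) = s ^^ k"
  by (induction k) (simp_all add: nat_pow_def Gal_def funpow_Suc_right del: funpow.simps)

lemma galois_group_iff: "s \<in> galois_group f \<longleftrightarrow> field_hom s \<and> bij s \<and> (\<forall>c. s (f c) = f c)"
  by (simp add: galois_group_def field_embedding_iff)

lemma inv_in_galois_group:
  assumes "s \<in> galois_group f"
  shows "inv_into UNIV s \<in> galois_group f"
proof -
  interpret s: field_hom s
    using assms by (simp add: galois_group_iff)
  have bij_s: "bij s"
    using assms by (simp add: galois_group_iff)
  then have inv_eq: "inv_into UNIV s y = x \<longleftrightarrow> y = s x" for x y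
    by (metis bij_inv_eq_iff)
  have "field_hom (inv_into UNIV s)"
    by unfold_locales (simp_all add: inv_eq s.homs bij_is_surj[OF bij_s] surj_f_inv_f)
  then show ?thesis
    using assms by (simp add: galois_group_iff inv_eq bij_imp_bij_inv)
qed

lemma group_Gal: "group (Gal f)"
proof (rule groupI)
  fix s assume s_mem: "s \<in> carrier (Gal f)"
  then have "inv_into UNIV s \<circ> s = id"
    by (simp add: galois_group_iff bij_is_inj)
  then show "\<exists>t\<in>carrier (Gal f). t \<otimes>\<^bsub>Gal f\<^esub> s = \<one>\<^bsub>Gal f\<^esub>"
    using inv_in_galois_group s_mem by auto
qed (auto simp: galois_group_iff field_hom_def field_hom_axioms_def additive_def bij_comp o_assoc)

locale totally_ramified_galois_extension = totally_ramified_extension v f \<pi>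
  for v :: "'n::field \<Rightarrow> int" and f :: "'k::field \<Rightarrow> 'n" and \<pi> :: 'n +
  assumes card_galois_group: "card (galois_group f) = ext_degree f"
begin

abbreviation G :: "('n \<Rightarrow> 'n) set" where
  "G \<equiv> galois_group f"

sublocale Gal: group "Gal f"
  by (rule group_Gal)

lemma finite_G [simp]: "finite G"
  using card_galois_group q_pos by (intro card_ge_0_finite) simp

lemma galois_hom: "s \<in> G \<Longrightarrow> field_hom s"
  and galois_base: "s \<in> G \<Longrightarrow> s (f c) = f c"
  by (auto simp: galois_group_iff)

lemma id_in_G [simp]: "id \<in> G"
  using Gal.one_closed by simp

lemma comp_in_G: "s \<in> G \<Longrightarrow> t \<in> G \<Longrightarrow> s \<circ> t \<in> G"
  using Gal.m_closed by simp

lemma galois_zero_iff: "s \<in> G \<Longrightarrow> s x = 0 \<longleftrightarrow> x = 0"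
  by (rule field_hom.eq_0_iff[OF galois_hom])

lemma v_galois: "s \<in> G \<Longrightarrow> v (s x) = v x"
  by (intro v_conjugate galois_hom) (auto simp: galois_base)

lemma vge_galois: "s \<in> G \<Longrightarrow> vge m (s x) \<longleftrightarrow> vge m x"
  by (simp add: vge_def v_galois galois_zero_iff)

lemma galois_eqI:
  assumes "s \<in> G" "t \<in> G" "s \<pi> = t \<pi>"
  shows "s = t"
proof
  fix x
  interpret s: field_hom s by (rule galois_hom[OF assms(1)])
  interpret t: field_hom t by (rule galois_hom[OF assms(2)])
  obtain c where "x = (\<Sum>i<q. f (c i) * \<pi> ^ i)"
    using pi_expansion .
  then show "s x = t x"
    using assms by (simp add: s.homs t.homs galois_base)
qed

lemma galois_pi_eq_iff: "s \<in> G \<Longrightarrow> s \<pi> = \<pi> \<longleftrightarrow> s = id"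
  using galois_eqI[of s id] by auto

subsection \<open>Ramification breaks of automorphisms\<close>

text \<open>The value of \<open>brk\<close> at \<open>id\<close>, whose break is infinite, is meaningless.\<close>

definition brk :: "('n \<Rightarrow> 'n) \<Rightarrow> int" where
  "brk s = v (s \<pi> - \<pi>) - 1"

lemma brk_nonneg:
  assumes "s \<in> G" "s \<noteq> id"
  shows "brk s \<ge> 0"
proof -
  have "vge 1 (s \<pi> - \<pi>)"
    using assms by (intro vge_diff) (simp_all add: vge_galois)
  then show ?thesis
    using assms galois_pi_eq_iff by (auto simp: vge_def brk_def)
qed

lemma vge_brk_iff: "s \<in> G \<Longrightarrow> vge (m + 1) (s \<pi> - \<pi>) \<longleftrightarrow> s = id \<or> m \<le> brk s"
  using galois_pi_eq_iff by (auto simp: vge_def brk_def)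

lemma brk_comp:
  assumes "s \<in> G" "t \<in> G" "s = id \<or> m \<le> brk s" "t = id \<or> m \<le> brk t"
  shows "s \<circ> t = id \<or> m \<le> brk (s \<circ> t)"
proof -
  interpret s: field_hom s by (rule galois_hom[OF assms(1)])
  have "vge (m + 1) (s (t \<pi> - \<pi>) + (s \<pi> - \<pi>))"
    using assms by (intro vge_add) (simp_all add: vge_galois vge_brk_iff)
  then show ?thesis
    using assms by (simp add: vge_brk_iff[symmetric] comp_in_G s.diff)
qed

lemma brk_inv:
  assumes "s \<in> G"
  shows "brk (inv_into UNIV s) = brk s"
proof -
  interpret s: field_hom s by (rule galois_hom[OF assms])
  have "s (inv_into UNIV s \<pi>) = \<pi>"
    using assms by (simp add: galois_group_iff bij_is_surj surj_f_inv_f)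
  then have "v (inv_into UNIV s \<pi> - \<pi>) = v (\<pi> - s \<pi>)"
    using v_galois[OF assms, of "inv_into UNIV s \<pi> - \<pi>"] by (simp add: s.diff)
  then show ?thesis
    by (simp add: brk_def v_minus_commute)
qed

end

locale galois_subgroup = totally_ramified_galois_extension v f \<pi>
  for v :: "'n::field \<Rightarrow> int" and f :: "'k::field \<Rightarrow> 'n" and \<pi> :: 'n and H :: "('n \<Rightarrow> 'n) set" +
  assumes subgroup_H: "subgroup H (Gal f)"

lemma (in totally_ramified_galois_extension) galois_subgroupI:
  assumes "subgroup H (Gal f)"
  shows "galois_subgroup v f \<pi> H"
  using assms totally_ramified_galois_extension_axioms
  by (intro galois_subgroup.intro galois_subgroup_axioms.intro)

context galois_subgroup
begin

abbreviation d :: nat where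
  "d \<equiv> card H"

lemma H_in_G: "h \<in> H \<Longrightarrow> h \<in> G"
  using subgroup.mem_carrier[OF subgroup_H] by simp

lemma id_in_H [simp]: "id \<in> H"
  using subgroup.one_closed[OF subgroup_H] by simp

lemma comp_notin_H: "s \<in> G \<Longrightarrow> s \<notin> H \<Longrightarrow> h \<in> H \<Longrightarrow> s \<circ> h \<notin> H"
  using Gal.mult_mem_subgroup_iff[OF subgroup_H, of h s] by simp

lemma finite_H [simp]: "finite H"
  using finite_subset[OF _ finite_G] H_in_G by blast

lemma d_pos: "d > 0"
  using id_in_H finite_H by (metis card_gt_0_iff empty_iff)

lemma bij_betw_comp_H: "s \<in> H \<Longrightarrow> bij_betw (\<lambda>h. s \<circ> h) H H"
  using Gal.bij_betw_subgroup_translate[OF subgroup_H] by simp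

subsection \<open>Fixed fields\<close>

definition fixed_field :: "'n set" where
  "fixed_field = {x. \<forall>h\<in>H. h x = x}"

lemma fixed_fieldD: "x \<in> fixed_field \<Longrightarrow> h \<in> H \<Longrightarrow> h x = x"
  by (simp add: fixed_field_def)

lemmas H_homs = field_hom.homs[OF galois_hom[OF H_in_G]]

lemma base_in_fixed_field: "f c \<in> fixed_field"
  and diff_in_fixed_field: "x \<in> fixed_field \<Longrightarrow> y \<in> fixed_field \<Longrightarrow> x - y \<in> fixed_field"
  and mult_in_fixed_field: "x \<in> fixed_field \<Longrightarrow> y \<in> fixed_field \<Longrightarrow> x * y \<in> fixed_field"
  and power_in_fixed_field: "x \<in> fixed_field \<Longrightarrow> x ^ i \<in> fixed_field"
  and power_int_in_fixed_field: "x \<in> fixed_field \<Longrightarrow> x powi k \<in> fixed_field"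
  by (auto simp: fixed_field_def H_homs galois_base H_in_G)

definition min_poly :: "'n poly" where
  "min_poly = (\<Prod>h\<in>H. [:- h \<pi>, 1:])"

lemma map_poly_min_poly:
  assumes "s \<in> G"
  shows "map_poly s min_poly = (\<Prod>h\<in>H. [:- (s \<circ> h) \<pi>, 1:])"
proof -
  interpret s: field_hom s by (rule galois_hom[OF assms])
  show ?thesis
    by (simp add: min_poly_def s.map_poly_prod map_poly_pCons s.homs)
qed

lemma coeff_min_poly_in_fixed_field: "coeff min_poly k \<in> fixed_field"
proof -
  have "h (coeff min_poly k) = coeff min_poly k" if h_mem: "h \<in> H" for h
  proof -
    have "map_poly h min_poly = min_poly"
      unfolding map_poly_min_poly[OF H_in_G[OF h_mem]] unfolding min_poly_def
      by (rule prod.reindex_bij_betw[OF bij_betw_comp_H[OF h_mem]])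
    then show ?thesis
      using coeff_map_poly[of h min_poly k] H_homs(1)[OF h_mem] by simp
  qed
  then show ?thesis
    by (simp add: fixed_field_def)
qed

text \<open>A prime element of the fixed field: the norm of \<open>\<pi>\<close> up to sign.\<close>

definition fixed_prime :: 'n where
  "fixed_prime = coeff min_poly 0"

lemma fixed_prime_in_fixed_field: "fixed_prime \<in> fixed_field"
  unfolding fixed_prime_def by (rule coeff_min_poly_in_fixed_field)

lemma fixed_prime_nonzero [simp]: "fixed_prime \<noteq> 0"
  and v_fixed_prime [simp]: "v fixed_prime = int d"
proof -
  have "poly min_poly 0 = (\<Prod>h\<in>H. - h \<pi>)"
    by (simp add: min_poly_def poly_prod)
  then have fixed_prime_eq: "fixed_prime = (\<Prod>h\<in>H. - h \<pi>)"
    by (simp add: fixed_prime_def poly_0_coeff_0)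
  show "fixed_prime \<noteq> 0" "v fixed_prime = int d"
    by (simp_all add: fixed_prime_eq v_prod galois_zero_iff v_galois H_in_G)
qed

subsection \<open>The different and the trace\<close>

text \<open>The derivative of the minimal polynomial of \<open>\<pi>\<close> over the fixed field, taken at \<open>\<pi>\<close>.\<close>

definition different :: 'n where
  "different = (\<Prod>h\<in>H - {id}. \<pi> - h \<pi>)"

definition brk_sum :: int where
  "brk_sum = (\<Sum>h\<in>H - {id}. brk h)"

lemma different_nonzero [simp]: "different \<noteq> 0"
  and v_different: "v different = brk_sum + int d - 1"
proof -
  have nonzero: "\<pi> - h \<pi> \<noteq> 0" if "h \<in> H - {id}" for h
    using that galois_pi_eq_iff[of h] by (auto simp: H_in_G)
  then show "different \<noteq> 0"
    by (simp add: different_def)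
  have "v different = (\<Sum>h\<in>H - {id}. brk h + 1)"
    unfolding different_def using nonzero
    by (subst v_prod) (auto simp: brk_def v_minus_commute[of \<pi>])
  also have "\<dots> = brk_sum + int d - 1"
    using d_pos by (simp add: sum.distrib brk_sum_def card_Diff_singleton of_nat_diff)
  finally show "v different = brk_sum + int d - 1" .
qed

lemma conjugate_different:
  assumes "g \<in> H"
  shows "g different = (\<Prod>h\<in>H - {g}. g \<pi> - h \<pi>)"
proof -
  have "bij_betw (\<lambda>h. g \<circ> h) (H - {id}) (H - {g})"
    using bij_betw_DiffI[OF bij_betw_comp_H[OF assms], of "{id}" "{g}"] assms by simp
  then have "(\<Prod>h\<in>H - {g}. g \<pi> - h \<pi>) = (\<Prod>h\<in>H - {id}. g \<pi> - (g \<circ> h) \<pi>)"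
    by (rule prod.reindex_bij_betw[symmetric])
  then show ?thesis
    by (simp add: different_def H_homs assms)
qed

definition trace :: "'n \<Rightarrow> 'n" where
  "trace x = (\<Sum>h\<in>H. h x)"

sublocale trace: additive trace
  by unfold_locales (simp add: trace_def H_homs sum.distrib)

lemma trace_mult: "c \<in> fixed_field \<Longrightarrow> trace (c * x) = c * trace x"
  by (auto simp: trace_def H_homs fixed_field_def sum_distrib_left intro: sum.cong)

lemma trace_in_fixed_field: "trace x \<in> fixed_field"
proof -
  have "g (trace x) = trace x" if "g \<in> H" for g
    using sum.reindex_bij_betw[OF bij_betw_comp_H[OF that], of "\<lambda>h. h x"] that
    by (simp add: trace_def H_homs)
  then show ?thesis
    by (simp add: fixed_field_def)
qed

lemma inj_on_conjugate_pi: "inj_on (\<lambda>h. h \<pi>) H"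
  by (auto simp: inj_on_def intro: galois_eqI H_in_G)

lemma card_conjugate_pi: "card ((\<lambda>h. h \<pi>) ` H) = d"
  by (rule card_image[OF inj_on_conjugate_pi])

lemma trace_pi_power_div_different:
  "trace (\<pi> ^ m / different) = divided_difference ((\<lambda>h. h \<pi>) ` H) (\<lambda>x. x ^ m)"
proof -
  have "g (\<pi> ^ m / different) = g \<pi> ^ m / (\<Prod>y\<in>(\<lambda>h. h \<pi>) ` H - {g \<pi>}. g \<pi> - y)"
    if g_mem: "g \<in> H" for g
  proof -
    have "(\<lambda>h. h \<pi>) ` H - {g \<pi>} = (\<lambda>h. h \<pi>) ` (H - {g})"
      using inj_on_conjugate_pi g_mem by (auto dest: inj_onD)
    then show ?thesis
      using inj_on_conjugate_pi g_mem
      by (simp add: H_homs conjugate_different prod.reindex inj_on_diff)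
  qed
  then show ?thesis
    by (simp add: trace_def divided_difference_def sum.reindex[OF inj_on_conjugate_pi])
qed

lemma trace_pi_power_div_different_eq_0: "Suc m < d \<Longrightarrow> trace (\<pi> ^ m / different) = 0"
  and trace_pi_power_div_different_eq_1: "trace (\<pi> ^ (d - 1) / different) = 1"
  using d_pos
  by (simp_all add: trace_pi_power_div_different card_conjugate_pi
      divided_difference_power_eq_0 divided_difference_power_eq_1)

lemma vge_trace:
  assumes "vge m x"
  shows "vge (m + brk_sum) (trace x)"
proof -
  define y where "y = x * different / \<pi> ^ (d - 1)"
  have y_eq: "\<pi> ^ (d - 1) * y = different * x"
    by (simp add: y_def)
  have "vge (m + v different) (\<pi> ^ (d - 1) * y)"
    unfolding y_eq using assms by (simp add: vge_mult_iff)
  then have "vge (m + brk_sum) y"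
    using d_pos by (simp add: vge_mult_iff v_different v_pi_power of_nat_diff)
  then obtain c where expansion: "y = (\<Sum>i<q. f (c i) * \<pi> ^ i)"
    and v_terms: "\<And>i. i < q \<Longrightarrow> vge (m + brk_sum) (f (c i) * \<pi> ^ i)"
    using pi_expansion_vge by blast
  have "x = \<pi> ^ (d - 1) * y / different"
    unfolding y_eq by simp
  also have "\<dots> = (\<Sum>i<q. f (c i) * (\<pi> ^ (d - 1 + i) / different))"
    by (simp add: expansion sum_distrib_left sum_divide_distrib power_add mult_ac)
  finally have "trace x = (\<Sum>i<q. f (c i) * trace (\<pi> ^ (d - 1 + i) / different))"
    by (simp only: trace.sum trace_mult base_in_fixed_field)
  moreover have "vge (m + brk_sum) (f (c i) * trace (\<pi> ^ (d - 1 + i) / different))" if "i < q" for i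
  proof -
    have "vge (m + brk_sum - int i) (f (c i))"
      using v_terms[OF that] vge_mult_iff[of "\<pi> ^ i"] by (simp add: v_pi_power mult.commute)
    moreover have "vge 1 x" if "x \<in> (\<lambda>h. h \<pi>) ` H" for x
      using that by (auto simp: vge_galois H_in_G)
    then have "vge (int i) (trace (\<pi> ^ (d - 1 + i) / different))"
      using vge_divided_difference_power[of "(\<lambda>h. h \<pi>) ` H" 1 "d - 1 + i"] d_pos
      by (simp add: trace_pi_power_div_different card_conjugate_pi of_nat_diff)
    ultimately show ?thesis
      using vge_mult by fastforce
  qed
  ultimately show ?thesis
    by (auto intro: vge_sum)
qed

lemma v_trace:
  assumes nonzero: "x \<noteq> 0" and dvd: "int d dvd v x + brk_sum"
  shows "trace x \<noteq> 0" "v (trace x) = v x + brk_sum"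
proof -
  obtain k where k_eq: "v x + brk_sum = int d * k"
    using dvd by (elim dvdE)
  define a c y where "a = \<pi> ^ (d - 1) / different" and "c = fixed_prime powi k"
    and "y = x / (c * a)"
  have v_a: "a \<noteq> 0" "v a = - brk_sum"
    using d_pos by (simp_all add: a_def v_divide v_pi_power v_different of_nat_diff)
  have v_c: "c \<noteq> 0" "v c = v x + brk_sum" "c \<in> fixed_field"
    by (simp_all add: c_def v_power_int k_eq power_int_in_fixed_field fixed_prime_in_fixed_field)
  have "y \<noteq> 0" "v y = 0"
    using nonzero v_a v_c by (simp_all add: y_def v_divide v_mult)
  then obtain e where residue: "e \<noteq> 0" "v (f e) = 0" "vge 1 (y - f e)"
    by (rule residue_representative)
  have "x = (c * f e) * a + c * (a * (y - f e))"
    using v_a v_c by (simp add: y_def field_simps)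
  then have split: "trace x = c * f e + c * trace (a * (y - f e))"
    using trace_pi_power_div_different_eq_1 v_c(3)
    by (simp only: trace.add trace_mult mult_in_fixed_field base_in_fixed_field a_def mult_1_right)
  have leading: "c * f e \<noteq> 0" "v (c * f e) = v c"
    using v_c residue by (simp_all add: v_mult)
  have "vge (v a + 1 + brk_sum) (trace (a * (y - f e)))"
    by (intro vge_trace vge_mult vge_v residue)
  then have "vge (v (c * f e) + 1) (c * trace (a * (y - f e)))"
    using v_c(1) v_a(2) by (simp add: leading(2) vge_mult_iff)
  then show "trace x \<noteq> 0" "v (trace x) = v x + brk_sum"
    using v_add_eq[OF leading(1)] unfolding split leading(2) v_c(2) by blast+
qed

lemma trace_eq_0_exists:
  assumes "\<not> int d dvd w + brk_sum"
  obtains x where "x \<noteq> 0" "v x = w" "trace x = 0"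
proof -
  define i where "i = nat ((w + v different) mod int d)"
  have i_eq: "int i = (w + v different) mod int d"
    using d_pos by (simp add: i_def)
  then obtain k where k_eq: "w + v different - int i = int d * k"
    by (metis dvd_minus_mod dvdE)
  have "i < d"
    using i_eq d_pos by (metis of_nat_0_less_iff of_nat_less_iff pos_mod_bound)
  moreover have "i \<noteq> d - 1"
    using k_eq assms d_pos by (auto simp: v_different of_nat_diff)
  ultimately have "Suc i < d"
    by simp
  define x where "x = fixed_prime powi k * (\<pi> ^ i / different)"
  have "x \<noteq> 0"
    by (simp add: x_def)
  moreover have "v x = w"
    using k_eq by (simp add: x_def v_mult v_divide v_power_int v_pi_power algebra_simps)
  moreover have "trace x = 0"
    using \<open>Suc i < d\<close>
    by (simp only: x_def trace_mult power_int_in_fixed_field fixed_prime_in_fixed_field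
        trace_pi_power_div_different_eq_0 mult_zero_right)
  ultimately show thesis
    by (rule that)
qed

text \<open>
  Otherwise some \<open>y\<close> of trace 0 would have the valuation that makes the trace of \<open>x * y\<close> nonzero.
\<close>

lemma dvd_v_fixed_field:
  assumes "x \<in> fixed_field" "x \<noteq> 0"
  shows "int d dvd v x"
proof (rule ccontr)
  assume "\<not> int d dvd v x"
  then have "\<not> int d dvd (- v x - brk_sum) + brk_sum"
    by simp
  then obtain y where trace_zero: "y \<noteq> 0" "v y = - v x - brk_sum" "trace y = 0"
    by (rule trace_eq_0_exists)
  have "trace (x * y) \<noteq> 0"
    using assms(2) trace_zero by (intro v_trace) (simp_all add: v_mult)
  then show False
    using trace_mult[OF assms(1)] trace_zero(3) by simp
qed

lemma fixed_field_vge_next: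
  assumes x_fixed: "x \<in> fixed_field" "vge (m + 1) x" and dvd_m: "int d dvd m"
  shows "vge (m + int d) x"
proof (cases "x = 0")
  case False
  then have "int d dvd v x - m"
    using dvd_v_fixed_field[OF x_fixed(1)] dvd_m by simp
  then show ?thesis
    using x_fixed(2) zdvd_imp_le[of "int d" "v x - m"] by (auto simp: vge_def)
qed simp

subsection \<open>Differences of conjugates\<close>

lemma fixed_field_leading_term:
  assumes x_fixed: "x \<in> fixed_field" "x \<noteq> 0"
  obtains c l y where "x = f c * fixed_prime ^ l + y" "c \<noteq> 0" "v x = v (f c) + int l * int d"
    "y \<in> fixed_field" "vge (v x + int d) y"
proof -
  have dvd: "int d dvd v x"
    by (rule dvd_v_fixed_field[OF x_fixed])
  then obtain k where k_eq: "v x = int d * k"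
    by (elim dvdE)
  define l where "l = nat (k mod int q)"
  have l_eq: "int l = k mod int q"
    using q_pos by (simp add: l_def)
  have "int q dvd v x - int l * int d"
    by (simp add: k_eq l_eq mult.commute[of _ "int d"] flip: right_diff_distrib)
  then obtain c where v_c: "c \<noteq> 0" "v (f c) = v x - int l * int d"
    by (rule v_base_surj)
  define t where "t = f c * fixed_prime ^ l"
  have v_t: "t \<noteq> 0" "v t = v x"
    using v_c by (simp_all add: t_def v_mult v_power)
  have "x / t \<noteq> 0" "v (x / t) = 0"
    using x_fixed(2) v_t by (simp_all add: v_divide)
  then obtain e where residue: "e \<noteq> 0" "v (f e) = 0" "vge 1 (x / t - f e)"
    by (rule residue_representative)
  define y where "y = x - f (c * e) * fixed_prime ^ l"
  have "y = t * (x / t - f e)"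
    using v_t(1) by (simp add: y_def t_def base.mult field_simps)
  then have "vge (v x + 1) y"
    using v_t residue(3) by (simp add: vge_mult_iff)
  moreover have "y \<in> fixed_field"
    using x_fixed(1) unfolding y_def
    by (intro diff_in_fixed_field mult_in_fixed_field base_in_fixed_field power_in_fixed_field
        fixed_prime_in_fixed_field)
  ultimately show thesis
    using that[of "c * e" l y] fixed_field_vge_next[OF _ _ dvd] v_c residue
    by (simp add: y_def base.mult v_mult)
qed

context
  fixes s :: "'n \<Rightarrow> 'n"
  assumes s: "s \<in> G"
begin

interpretation s: field_hom s
  by (rule galois_hom[OF s])

lemma diff_leading_term:
  assumes "x = f c * fixed_prime ^ l + y"
  shows "s x - x = f c * (s fixed_prime ^ l - fixed_prime ^ l) + (s y - y)"
  using s by (simp add: assms s.homs galois_base algebra_simps)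

text \<open>
  Splitting off leading terms improves the trivial bound \<open>v (s x - x) \<ge> v x\<close> by \<open>d\<close> at each step,
  until it is limited by the differences of the powers of \<open>fixed_prime\<close>.
\<close>

lemma vge_diff_fixed_field_iterated:
  assumes prime_diff: "vge (int d + r) (s fixed_prime - fixed_prime)" "0 \<le> r"
    and x_fixed: "x \<in> fixed_field" "vge m x"
  shows "vge (m + min r (int k * int d)) (s x - x)"
  using x_fixed
proof (induction k arbitrary: m x)
  case 0
  then show ?case
    using prime_diff(2) by (simp add: vge_diff vge_galois s)
next
  case (Suc k)
  show ?case
  proof (cases "x = 0")
    case True
    then show ?thesis
      by (simp add: s.zero)
  next
    case False
    obtain c l y where x_eq: "x = f c * fixed_prime ^ l + y"
      and v_x: "v x = v (f c) + int l * int d"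
      and remainder: "y \<in> fixed_field" "vge (v x + int d) y"
      using fixed_field_leading_term[OF Suc.prems(1) False] .
    have m_le: "m \<le> v x"
      using Suc.prems(2) False by (simp add: vge_def)
    have "vge (int l * int d + r) (s fixed_prime ^ l - fixed_prime ^ l)"
      using vge_power_diff[of fixed_prime r "s fixed_prime" l] prime_diff by simp
    then have "vge (v (f c) + (int l * int d + r)) (f c * (s fixed_prime ^ l - fixed_prime ^ l))"
      by (intro vge_mult vge_v)
    then have "vge (m + min r (int (Suc k) * int d)) (f c * (s fixed_prime ^ l - fixed_prime ^ l))"
      by (rule vge_mono) (use v_x m_le in simp)
    moreover have "vge (m + min r (int (Suc k) * int d)) (s y - y)"
      by (rule vge_mono[OF Suc.IH[OF remainder]]) (use m_le d_pos in \<open>simp add: algebra_simps\<close>)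
    ultimately show ?thesis
      by (simp only: diff_leading_term[OF x_eq] vge_add)
  qed
qed

lemma vge_diff_fixed_field:
  assumes prime_diff: "vge (int d + r) (s fixed_prime - fixed_prime)" "0 \<le> r"
    and x_fixed: "x \<in> fixed_field" "vge m x"
  shows "vge (m + r) (s x - x)"
proof -
  have "r * 1 \<le> int (nat r) * int d"
    using prime_diff(2) d_pos by (intro mult_mono) auto
  then show ?thesis
    using vge_diff_fixed_field_iterated[OF prime_diff x_fixed, of "nat r"]
    by (simp add: min_absorb1)
qed

lemma v_diff_fixed_field:
  assumes residue_char: "vge 1 (of_nat p)" "prime p" "p * d dvd q"
    and prime_diff: "s fixed_prime \<noteq> fixed_prime" "v (s fixed_prime - fixed_prime) = int d + r"
      "0 < r"
    and x_fixed: "x \<in> fixed_field" "x \<noteq> 0" "\<not> int (p * d) dvd v x"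
  shows "s x \<noteq> x" "v (s x - x) = v x + r"
proof -
  obtain c l y where x_eq: "x = f c * fixed_prime ^ l + y"
    and leading: "c \<noteq> 0" "v x = v (f c) + int l * int d"
    and remainder: "y \<in> fixed_field" "vge (v x + int d) y"
    using fixed_field_leading_term[OF x_fixed(1,2)] .
  have "int (p * d) dvd v (f c)"
    using residue_char(3) dvd_v_base[OF leading(1)] by (meson dvd_trans of_nat_dvd_iff)
  then have "\<not> int p * int d dvd int l * int d"
    using x_fixed(3) leading(2) by (simp add: dvd_add_right_iff)
  then have "\<not> p dvd l"
    using d_pos by simp
  then have "coprime l p"
    using prime_imp_coprime[OF residue_char(2)] by (simp add: coprime_commute)
  note unit = v_of_nat_coprime[OF residue_char(1) this]
  have "s fixed_prime ^ l \<noteq> fixed_prime ^ l"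
    "v (s fixed_prime ^ l - fixed_prime ^ l) = int l * int d + r"
    using v_power_diff[OF fixed_prime_nonzero prime_diff(1) _ prime_diff(3) unit] prime_diff(2)
    by simp_all
  then have leading_diff: "f c * (s fixed_prime ^ l - fixed_prime ^ l) \<noteq> 0"
    "v (f c * (s fixed_prime ^ l - fixed_prime ^ l)) = v x + r"
    using leading v_mult[of "f c" "s fixed_prime ^ l - fixed_prime ^ l"] by simp_all
  have "vge (int d + r) (s fixed_prime - fixed_prime)"
    using prime_diff(2) by (simp add: vge_def)
  then have "vge (v x + int d + r) (s y - y)"
    by (rule vge_diff_fixed_field) (use remainder prime_diff(3) in simp_all)
  then have "vge (v x + r + 1) (s y - y)"
    by (rule vge_mono) (use d_pos in simp)
  then show "s x \<noteq> x" "v (s x - x) = v x + r"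
    using v_add_eq[OF leading_diff(1), of "s y - y"] leading_diff(2) diff_leading_term[OF x_eq]
    by auto
qed

subsection \<open>Herbrand's theorem\<close>

text \<open>
  The value at \<open>\<pi>\<close> of the difference between the minimal polynomial of \<open>\<pi>\<close> over the fixed field and
  its conjugate is known from the breaks, and it is dominated by the constant coefficient.
\<close>

lemma poly_conjugate_min_poly:
  assumes "s \<notin> H"
  shows "poly (map_poly s min_poly - min_poly) \<pi> \<noteq> 0"
    "v (poly (map_poly s min_poly - min_poly) \<pi>) = int d + (\<Sum>h\<in>H. brk (s \<circ> h))"
proof -
  have nonzero: "\<pi> - (s \<circ> h) \<pi> \<noteq> 0" if "h \<in> H" for h
    using galois_pi_eq_iff[OF comp_in_G[OF s H_in_G[OF that]]] comp_notin_H[OF s assms that] by auto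
  have "poly min_poly \<pi> = 0"
    by (auto simp: min_poly_def poly_prod intro!: bexI[of _ id])
  then have prod_eq: "poly (map_poly s min_poly - min_poly) \<pi> = (\<Prod>h\<in>H. \<pi> - (s \<circ> h) \<pi>)"
    by (simp add: map_poly_min_poly[OF s] poly_prod)
  show "poly (map_poly s min_poly - min_poly) \<pi> \<noteq> 0"
    unfolding prod_eq using nonzero by simp
  show "v (poly (map_poly s min_poly - min_poly) \<pi>) = int d + (\<Sum>h\<in>H. brk (s \<circ> h))"
    unfolding prod_eq using nonzero
    by (subst v_prod) (auto simp: brk_def v_minus_commute[of \<pi>] sum_subtractf)
qed

lemma vge_coeff_conjugate_min_poly:
  assumes prime_diff: "vge (int d + r) (s fixed_prime - fixed_prime)" "0 \<le> r"
  shows "vge (int d + r) (coeff (map_poly s min_poly - min_poly) k)"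
proof -
  have coeff_eq:
    "coeff (map_poly s min_poly - min_poly) k = s (coeff min_poly k) - coeff min_poly k"
    by (simp add: coeff_map_poly s.zero)
  consider "coeff min_poly k = 0" | "k = d" | "k < d"
    using le_degree[of min_poly k] by (fastforce simp: min_poly_def degree_prod_linear)
  then show ?thesis
  proof cases
    case 2
    then have "coeff min_poly k = 1"
      using lead_coeff_prod_linear[of "\<lambda>h. h \<pi>" H] by (simp add: min_poly_def degree_prod_linear)
    then show ?thesis
      unfolding coeff_eq by (simp add: s.one)
  next
    case 3
    have "vge (1 * (int d - int k)) (coeff min_poly k)"
      unfolding min_poly_def by (intro vge_coeff_prod_linear) (simp_all add: vge_galois H_in_G)
    then have "vge (0 + 1) (coeff min_poly k)"
      by (rule vge_mono) (use 3 in simp)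
    then have "vge (int d) (coeff min_poly k)"
      using fixed_field_vge_next[OF coeff_min_poly_in_fixed_field, of 0] by simp
    then show ?thesis
      unfolding coeff_eq by (rule vge_diff_fixed_field[OF prime_diff coeff_min_poly_in_fixed_field])
  qed (unfold coeff_eq, simp add: s.zero)
qed

lemma vge_poly_conjugate_min_poly:
  assumes "vge (int d + r) (s fixed_prime - fixed_prime)" "0 \<le> r"
  shows "vge (int d + r + 1)
    (poly (map_poly s min_poly - min_poly) \<pi> - (s fixed_prime - fixed_prime))"
proof -
  obtain a D where D_eq: "map_poly s min_poly - min_poly = pCons a D"
    by (cases "map_poly s min_poly - min_poly")
  have a_eq: "a = s fixed_prime - fixed_prime"
    using arg_cong[OF D_eq, of "\<lambda>F. coeff F 0"] by (simp add: fixed_prime_def coeff_map_poly s.zero)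
  have "vge (int d + r) (coeff D k)" for k
    using vge_coeff_conjugate_min_poly[OF assms, of "Suc k"] by (simp add: D_eq)
  then have "vge (1 + (int d + r)) (\<pi> * poly D \<pi>)"
    by (intro vge_mult vge_poly vge_pi) (simp_all add: vge_def)
  then show ?thesis
    unfolding D_eq a_eq by (simp add: add.commute)
qed

end

theorem herbrand:
  assumes outside: "s \<in> G" "s \<notin> H"
  shows "s fixed_prime \<noteq> fixed_prime"
    and "v (s fixed_prime - fixed_prime) = int d + (\<Sum>h\<in>H. brk (s \<circ> h))"
proof -
  let ?D = "poly (map_poly s min_poly - min_poly) \<pi>" and ?a = "s fixed_prime - fixed_prime"
  show neq: "s fixed_prime \<noteq> fixed_prime"
  proof
    assume eq: "s fixed_prime = fixed_prime"
    have "vge (int d + max 0 (v ?D) + 1) ?D"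
      using vge_poly_conjugate_min_poly[OF outside(1), of "max 0 (v ?D)"] by (simp add: eq)
    then show False
      using poly_conjugate_min_poly(1)[OF outside] by (simp add: vge_def)
  qed
  have "vge (int d) ?a"
    using outside(1) by (intro vge_diff) (simp_all add: vge_def v_galois)
  then have "vge (v ?a + 1) (?D - ?a)"
    using vge_poly_conjugate_min_poly[OF outside(1), of "v ?a - int d"] neq by (simp add: vge_def)
  then have "v ?D = v ?a"
    using v_add_eq(2)[of ?a "?D - ?a"] neq by simp
  then show "v ?a = int d + (\<Sum>h\<in>H. brk (s \<circ> h))"
    using poly_conjugate_min_poly(2)[OF outside] by simp
qed

end

subsection \<open>Upper breaks\<close>

lemma min_nth_sorted_eq_sum:
  fixes bs :: "'a::linordered_idom list"
  assumes sorted_bs: "sorted bs" and x_mem: "x \<in> set bs" and k_less: "k < length bs"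
  shows "min x (bs ! k) = bs ! 0 + (\<Sum>j=1..k. if bs ! j \<le> x then bs ! j - bs ! (j - 1) else 0)"
  using k_less
proof (induction k)
  case 0
  obtain l where "l < length bs" "x = bs ! l"
    using x_mem by (auto simp: in_set_conv_nth)
  then show ?case
    using sorted_nth_mono[OF sorted_bs, of 0 l] by simp
next
  case (Suc k)
  have step_le: "bs ! k \<le> bs ! Suc k"
    using Suc.prems by (intro sorted_nth_mono[OF sorted_bs]) auto
  obtain l where x_nth: "l < length bs" "x = bs ! l"
    using x_mem by (auto simp: in_set_conv_nth)
  have "x \<le> bs ! k \<or> bs ! Suc k \<le> x"
    using sorted_nth_mono[OF sorted_bs, of l k] sorted_nth_mono[OF sorted_bs, of "Suc k" l]
      Suc.prems x_nth
    by (cases "l \<le> k") auto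
  then have
    "min x (bs ! Suc k) = min x (bs ! k) + (if bs ! Suc k \<le> x then bs ! Suc k - bs ! k else 0)"
    using step_le by auto
  then show ?case
    using Suc by simp
qed

lemma sum_min_nth_sorted:
  fixes bs :: "'a::linordered_idom list"
  assumes "finite A" "sorted bs" "\<And>a. a \<in> A \<Longrightarrow> \<tau> a \<in> set bs" "k < length bs"
  shows "(\<Sum>a\<in>A. min (\<tau> a) (bs ! k)) = bs ! 0 * of_nat (card A)
    + (\<Sum>j=1..k. (bs ! j - bs ! (j - 1)) * of_nat (card {a\<in>A. bs ! j \<le> \<tau> a}))"
proof -
  have "(\<Sum>a\<in>A. min (\<tau> a) (bs ! k))
      = (\<Sum>a\<in>A. bs ! 0 + (\<Sum>j=1..k. if bs ! j \<le> \<tau> a then bs ! j - bs ! (j - 1) else 0))"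
    using assms by (intro sum.cong refl min_nth_sorted_eq_sum)
  also have "\<dots> = bs ! 0 * of_nat (card A)
      + (\<Sum>j=1..k. \<Sum>a\<in>A. if bs ! j \<le> \<tau> a then bs ! j - bs ! (j - 1) else 0)"
    by (simp add: sum.distrib sum.swap[of _ A] mult.commute)
  also have "\<dots> = bs ! 0 * of_nat (card A)
      + (\<Sum>j=1..k. (bs ! j - bs ! (j - 1)) * of_nat (card {a\<in>A. bs ! j \<le> \<tau> a}))"
    using assms(1) by (simp add: sum.inter_filter[symmetric] mult.commute)
  finally show ?thesis .
qed

context totally_ramified_galois_extension
begin

abbreviation b_max :: int where
  "b_max \<equiv> Max (lower_breaks f v \<pi>)"

text \<open>The break of \<open>id\<close> is infinite; for sums of truncations at a break, \<open>b_max\<close> is as good.\<close>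

definition brk_ext :: "('n \<Rightarrow> 'n) \<Rightarrow> int" where
  "brk_ext g = (if g = id then b_max else brk g)"

lemma lower_ram_group_eq: "lower_ram_group f v \<pi> b = {g \<in> G. g = id \<or> b \<le> brk g}"
  by (auto simp: lower_ram_group_def brk_def galois_pi_eq_iff)

lemma lower_breaks_eq: "lower_breaks f v \<pi> = brk ` (G - {id})"
proof (intro equalityI subsetI)
  fix b assume "b \<in> lower_breaks f v \<pi>"
  then show "b \<in> brk ` (G - {id})"
    by (force simp: lower_breaks_def lower_ram_group_eq)
next
  fix b assume "b \<in> brk ` (G - {id})"
  then obtain g where "g \<in> G" "g \<noteq> id" "b = brk g"
    by auto
  then show "b \<in> lower_breaks f v \<pi>"
    using brk_nonneg[of g] by (force simp: lower_breaks_def lower_ram_group_eq)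
qed

lemma finite_lower_breaks [simp]: "finite (lower_breaks f v \<pi>)"
  by (simp add: lower_breaks_eq)

lemma b_max_in_lower_breaks:
  assumes "G \<noteq> {id}"
  shows "b_max \<in> lower_breaks f v \<pi>"
proof (rule Max_in)
  show "lower_breaks f v \<pi> \<noteq> {}"
    using assms id_in_G by (auto simp: lower_breaks_eq)
qed simp

lemma b_max_attained:
  assumes "G \<noteq> {id}"
  obtains g where "g \<in> G" "g \<noteq> id" "brk g = b_max"
proof -
  obtain g where "b_max = brk g" "g \<in> G - {id}"
    using b_max_in_lower_breaks[OF assms] unfolding lower_breaks_eq by (rule imageE)
  then show thesis
    using that[of g] by simp
qed

lemma brk_le_b_max: "g \<in> G \<Longrightarrow> g \<noteq> id \<Longrightarrow> brk g \<le> b_max"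
  by (simp add: lower_breaks_eq)

lemma brk_ext_le_b_max: "g \<in> G \<Longrightarrow> brk_ext g \<le> b_max"
  by (simp add: brk_ext_def brk_le_b_max)

lemma le_brk_ext_iff:
  assumes "g \<in> G"
  shows "m \<le> brk_ext g \<longleftrightarrow> m \<le> b_max \<and> (g = id \<or> m \<le> brk g)"
  using brk_le_b_max[OF assms] by (auto simp: brk_ext_def)

lemma le_brk_ext_comp:
  assumes "s \<in> G" "t \<in> G" "m \<le> brk_ext s" "m \<le> brk_ext t"
  shows "m \<le> brk_ext (s \<circ> t)"
  using assms brk_comp[of s t m] by (auto simp: le_brk_ext_iff comp_in_G)

lemma le_brk_ext_inv:
  assumes "s \<in> G" "m \<le> brk_ext s"
  shows "m \<le> brk_ext (inv_into UNIV s)"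
  using assms inv_in_galois_group[OF assms(1)] by (cases "s = id") (auto simp: le_brk_ext_iff brk_inv)

lemma le_brk_ext_funpow:
  assumes "s \<in> G" "m \<le> brk_ext s"
  shows "s ^^ k \<in> G" "m \<le> brk_ext (s ^^ k)"
proof (induction k)
  case 0
  show "s ^^ 0 \<in> G" "m \<le> brk_ext (s ^^ 0)"
    using assms by (simp_all add: le_brk_ext_iff)
next
  case (Suc k)
  then show "s ^^ Suc k \<in> G" "m \<le> brk_ext (s ^^ Suc k)"
    using assms by (auto intro: comp_in_G le_brk_ext_comp)
qed

lemma min_brk_ext_comp:
  assumes s_break: "s \<in> G" "m \<le> brk_ext s" and t_mem: "t \<in> G"
  shows "min (brk_ext (s \<circ> t)) m = min (brk_ext t) m"
proof -
  have inv_break: "inv_into UNIV s \<in> G" "m \<le> brk_ext (inv_into UNIV s)"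
    using s_break le_brk_ext_inv inv_in_galois_group by auto
  have "inv_into UNIV s \<circ> (s \<circ> t) = t"
    using s_break(1) by (simp add: galois_group_iff bij_is_inj flip: comp_assoc)
  then have "min (brk_ext (s \<circ> t)) m \<le> brk_ext t"
    using le_brk_ext_comp[OF inv_break(1) comp_in_G[OF s_break(1) t_mem],
        of "min (brk_ext (s \<circ> t)) m"] inv_break(2)
    by simp
  moreover have "min (brk_ext t) m \<le> brk_ext (s \<circ> t)"
    using s_break t_mem by (intro le_brk_ext_comp) auto
  ultimately show ?thesis
    by linarith
qed

text \<open>The degree times the Herbrand function.\<close>

definition herbrand_sum :: "int \<Rightarrow> int" where
  "herbrand_sum b = (\<Sum>g\<in>G. min (brk_ext g) b)"

lemma upper_break_eq:
  assumes k_less: "k < card (lower_breaks f v \<pi>)"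
  shows "upper_break f v \<pi> k
    = of_int (herbrand_sum (sorted_list_of_set (lower_breaks f v \<pi>) ! k)) / of_nat q"
proof -
  define bs where "bs = sorted_list_of_set (lower_breaks f v \<pi>)"
  have bs_facts: "length bs = card (lower_breaks f v \<pi>)" "set bs = lower_breaks f v \<pi>" "sorted bs"
    by (simp_all add: bs_def)
  have "G \<noteq> {id}"
    using k_less by (auto simp: lower_breaks_eq)
  then have brk_ext_in: "brk_ext g \<in> set bs" if "g \<in> G" for g
    unfolding bs_facts(2) using that b_max_in_lower_breaks lower_breaks_eq
    by (simp add: brk_ext_def)
  have card_eq: "card (lower_ram_group f v \<pi> (bs ! j)) = card {g\<in>G. bs ! j \<le> brk_ext g}"
    if "j \<le> k" for j
  proof -
    have "bs ! j \<le> b_max"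
      using that k_less nth_mem[of j bs] by (simp add: bs_facts)
    then show ?thesis
      by (auto simp: lower_ram_group_eq le_brk_ext_iff intro: arg_cong[where f = card])
  qed
  have "bs ! 0 \<le> brk_ext g" if g_mem: "g \<in> G" for g
    using brk_ext_in[OF g_mem] sorted_nth_mono[OF bs_facts(3) le0] by (metis in_set_conv_nth)
  then have "{g\<in>G. bs ! 0 \<le> brk_ext g} = G"
    by auto
  then have card_0: "card (lower_ram_group f v \<pi> (bs ! 0)) = q"
    using card_eq[of 0] card_galois_group by simp
  have "herbrand_sum (bs ! k) = bs ! 0 * int (card G)
      + (\<Sum>j=1..k. (bs ! j - bs ! (j - 1)) * int (card {g\<in>G. bs ! j \<le> brk_ext g}))"
    unfolding herbrand_sum_def by (rule sum_min_nth_sorted) (use bs_facts brk_ext_in k_less in auto)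
  then have "herbrand_sum (bs ! k) = bs ! 0 * int (card (lower_ram_group f v \<pi> (bs ! 0)))
      + (\<Sum>j=1..k. (bs ! j - bs ! (j - 1)) * int (card (lower_ram_group f v \<pi> (bs ! j))))"
    by (simp add: card_0 card_galois_group card_eq cong: sum.cong_simp)
  then show ?thesis
    using q_pos card_0 unfolding upper_break_def Let_def bs_def[symmetric]
    by (cases "k = 0") simp_all
qed

lemma herbrand_sum_brk_eq_upper_break:
  assumes "g \<in> G" "g \<noteq> id"
  shows "of_int (herbrand_sum (brk g)) / of_nat q \<in> upper_breaks f v \<pi>"
proof -
  have "brk g \<in> set (sorted_list_of_set (lower_breaks f v \<pi>))"
    using assms by (simp add: lower_breaks_eq)
  then obtain k
    where "k < card (lower_breaks f v \<pi>)" "sorted_list_of_set (lower_breaks f v \<pi>) ! k = brk g"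
    unfolding in_set_conv_nth length_sorted_list_of_set by blast
  then show ?thesis
    using upper_break_eq[of k] unfolding upper_breaks_def by (metis imageI lessThan_iff)
qed

end

lemma (in galois_subgroup) sum_brk_ext: "(\<Sum>h\<in>H. brk_ext h) = b_max + brk_sum"
  by (subst sum.remove[of _ id]) (simp_all add: brk_ext_def brk_sum_def)

subsection \<open>Elementary abelian extensions\<close>

locale elementary_abelian_extension = totally_ramified_galois_extension v f \<pi>
  for v :: "'n::field_char_0 \<Rightarrow> int" and f :: "'k::field_char_0 \<Rightarrow> 'n" and \<pi> :: 'n +
  fixes p :: nat
  assumes prime_p: "prime p"
    and v_p_pos: "v (of_nat p) > 0"
    and elementary: "elementary_abelian p (galois_group f)"
begin

sublocale Gal: elementary_abelian_group "Gal f" p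
  using prime_p elementary by unfold_locales (auto simp: elementary_abelian_def)

lemma galois_commute: "s \<in> G \<Longrightarrow> t \<in> G \<Longrightarrow> s (t x) = t (s x)"
  using Gal.m_comm[of s t] by (simp add: fun_eq_iff)

lemma funpow_in_G: "s \<in> G \<Longrightarrow> s ^^ k \<in> G"
  using Gal.nat_pow_closed[of s k] by simp

end

locale index_p_subgroup = elementary_abelian_extension v f \<pi> p + galois_subgroup v f \<pi> H
  for v :: "'n::field_char_0 \<Rightarrow> int" and f :: "'k::field_char_0 \<Rightarrow> 'n" and \<pi> p H +
  fixes s :: "'n \<Rightarrow> 'n"
  assumes s_in_G: "s \<in> G" and s_notin_H: "s \<notin> H" and adjoin_H_s: "Gal.adjoin H s = G"
begin

lemma sum_G: "(\<Sum>g\<in>G. F g) = (\<Sum>i<p. \<Sum>h\<in>H. F (s ^^ i \<circ> h))"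
  using Gal.sum_adjoin[OF subgroup_H, of s F] s_in_G s_notin_H by (simp add: adjoin_H_s)

lemma q_eq: "q = p * d"
  using sum_G[of "\<lambda>_. 1 :: nat"] by (simp add: card_galois_group)

lemma coset_sum_eq_0:
  assumes "\<And>i. i < p \<Longrightarrow> Gal.coset_sum C H (s ^^ i) = 0" "g \<in> G"
  shows "Gal.coset_sum C H g = 0"
proof -
  obtain i h where "i < p" "h \<in> H" "g = s ^^ i \<circ> h"
    using assms(2) Gal.adjoin_eq_image[of s H] s_in_G by (auto simp: adjoin_H_s)
  then show ?thesis
    using Gal.coset_sum_mult_right[OF subgroup_H, of "s ^^ i" h C] assms(1) s_in_G
    by (simp add: funpow_in_G)
qed

lemma trace_combination:
  "trace (\<Sum>g\<in>G. f (C g) * g x) = (\<Sum>i<p. f (Gal.coset_sum C H (s ^^ i)) * (s ^^ i) (trace x))"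
proof -
  have trace_g: "trace (g x) = g (trace x)" if g_mem: "g \<in> G" for g
  proof -
    interpret g: field_hom g by (rule galois_hom[OF g_mem])
    show ?thesis
      by (simp add: trace_def g.sum galois_commute[OF H_in_G g_mem])
  qed
  have "trace (\<Sum>g\<in>G. f (C g) * g x) = (\<Sum>g\<in>G. f (C g) * g (trace x))"
    by (simp add: trace.sum trace_mult base_in_fixed_field trace_g)
  also have "\<dots> = (\<Sum>i<p. \<Sum>h\<in>H. f (C (s ^^ i \<circ> h)) * (s ^^ i) (trace x))"
    unfolding sum_G using trace_in_fixed_field[of x]
    by (intro sum.cong refl) (simp add: fixed_fieldD)
  finally show ?thesis
    by (simp add: Gal.coset_sum_def base.sum sum_distrib_right)
qed

abbreviation \<Delta> :: "'n \<Rightarrow> 'n" where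
  "\<Delta> y \<equiv> s y - y"

lemma Delta_in_fixed_field:
  assumes "x \<in> fixed_field"
  shows "\<Delta> x \<in> fixed_field"
proof -
  have "h (\<Delta> x) = \<Delta> x" if h_mem: "h \<in> H" for h
    using h_mem
    by (simp add: H_homs galois_commute[OF H_in_G[OF h_mem] s_in_G] fixed_fieldD[OF assms h_mem])
  then show ?thesis
    by (simp add: fixed_field_def)
qed

definition conjugate_brk_sum :: int where
  "conjugate_brk_sum = (\<Sum>h\<in>H. brk (s \<circ> h))"

lemma v_Delta:
  assumes "conjugate_brk_sum > 0" "x \<in> fixed_field" "x \<noteq> 0" "\<not> int q dvd v x"
  shows "\<Delta> x \<noteq> 0" "v (\<Delta> x) = v x + conjugate_brk_sum"
proof -
  have residue_char: "vge 1 (of_nat p)"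
    using v_p_pos by (simp add: vge_def)
  show "\<Delta> x \<noteq> 0" "v (\<Delta> x) = v x + conjugate_brk_sum"
    using v_diff_fixed_field[OF s_in_G residue_char prime_p, of conjugate_brk_sum x] assms
      herbrand[OF s_in_G s_notin_H] by (simp_all add: q_eq conjugate_brk_sum_def)
qed

lemma v_funpow_Delta:
  assumes sum_pos: "conjugate_brk_sum > 0" and x_fixed: "x \<in> fixed_field" "x \<noteq> 0"
    and ndvd: "\<And>k. Suc k < p \<Longrightarrow> \<not> int q dvd v x + int k * conjugate_brk_sum"
    and k_less: "k < p"
  shows "(\<Delta> ^^ k) x \<in> fixed_field \<and> (\<Delta> ^^ k) x \<noteq> 0 \<and>
    v ((\<Delta> ^^ k) x) = v x + int k * conjugate_brk_sum"
  using k_less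
proof (induction k)
  case 0
  then show ?case
    using x_fixed by simp
next
  case (Suc k)
  let ?y = "(\<Delta> ^^ k) x"
  have iterate: "?y \<in> fixed_field" "?y \<noteq> 0" "v ?y = v x + int k * conjugate_brk_sum"
    using Suc by simp_all
  then show ?case
    using Delta_in_fixed_field[OF iterate(1)] v_Delta[OF sum_pos iterate(1,2)] ndvd[OF Suc.prems]
    by (simp add: algebra_simps)
qed

lemma conjugates_independent_if_incongruent:
  assumes nonzero: "\<And>k. k < p \<Longrightarrow> (\<Delta> ^^ k) x \<noteq> 0"
    and incongruent: "inj_on (\<lambda>k. v ((\<Delta> ^^ k) x) mod int q) {..<p}"
    and zero: "(\<Sum>i<p. f (c i) * (s ^^ i) x) = 0" and i_less: "i < p"
  shows "c i = 0"
proof -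
  define b where "b k = (\<Sum>i<p. c i * of_nat (i choose k))" for k
  have "(s ^^ i) x = (\<Sum>k<p. of_nat (i choose k) * (\<Delta> ^^ k) x)" if "i < p" for i
    unfolding additive_funpow_eq_binomial_sum[OF field_hom.axioms(1)[OF galois_hom[OF s_in_G]]]
    by (rule sum.mono_neutral_left) (use that in \<open>auto simp: binomial_eq_0\<close>)
  then have
    "(\<Sum>i<p. f (c i) * (s ^^ i) x) = (\<Sum>i<p. \<Sum>k<p. f (c i * of_nat (i choose k)) * (\<Delta> ^^ k) x)"
    by (simp add: sum_distrib_left base.homs mult.assoc)
  also have "\<dots> = (\<Sum>k<p. f (b k) * (\<Delta> ^^ k) x)"
    by (subst sum.swap) (simp add: b_def base.homs sum_distrib_right)
  finally have "(\<Sum>k<p. f (b k) * (\<Delta> ^^ k) x) = 0"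
    using zero by simp
  then have "\<forall>k\<in>{..<p}. b k = 0"
    using nonzero by (intro incongruent_combination_eq_0[OF _ _ incongruent]) auto
  then show ?thesis
    using binomial_sums_eq_0[of p c i] i_less by (simp add: b_def)
qed

lemma v_funpow_Delta_incongruent:
  assumes quotient_break: "conjugate_brk_sum = int d * u" "u > 0" "coprime u (int p)"
    and x_cong: "x \<in> fixed_field" "x \<noteq> 0" "v x = int d * w" "[w = u] (mod int p)"
  shows "\<forall>k<p. (\<Delta> ^^ k) x \<noteq> 0" "inj_on (\<lambda>k. v ((\<Delta> ^^ k) x) mod int q) {..<p}"
proof -
  have sum_pos: "conjugate_brk_sum > 0"
    using quotient_break(1,2) d_pos by simp
  have v_eq: "v x + int k * conjugate_brk_sum = int d * (w + int k * u)" for k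
    by (simp add: quotient_break(1) x_cong(3) algebra_simps)
  have q_dvd_iff: "int q dvd int d * m \<longleftrightarrow> int p dvd m" for m
    using d_pos by (auto simp: q_eq mult.commute[of "int p"])
  have p_dvd_iff: "int p dvd m * u \<longleftrightarrow> int p dvd m" for m
    using quotient_break(3) by (simp add: coprime_commute coprime_dvd_mult_left_iff)
  have "\<not> int q dvd v x + int k * conjugate_brk_sum" if "Suc k < p" for k
  proof -
    have "[w + int k * u = int (Suc k) * u] (mod int p)"
      using cong_add[OF x_cong(4) cong_refl[of "int k * u"]] by (simp add: algebra_simps)
    then have "int p dvd w + int k * u \<longleftrightarrow> int p dvd int (Suc k)"
      using cong_dvd_iff p_dvd_iff by metis
    then show ?thesis
      using that by (auto simp: v_eq q_dvd_iff simp del: of_nat_Suc dest: dvd_imp_le)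
  qed
  then have v_Delta_k: "(\<Delta> ^^ k) x \<noteq> 0" "v ((\<Delta> ^^ k) x) = int d * (w + int k * u)" if "k < p" for k
    using v_funpow_Delta[OF sum_pos x_cong(1,2) _ that] v_eq by simp_all
  show "\<forall>k<p. (\<Delta> ^^ k) x \<noteq> 0"
    using v_Delta_k(1) by blast
  show "inj_on (\<lambda>k. v ((\<Delta> ^^ k) x) mod int q) {..<p}"
  proof (rule inj_onI)
    fix k l assume less: "k \<in> {..<p}" "l \<in> {..<p}"
      and "v ((\<Delta> ^^ k) x) mod int q = v ((\<Delta> ^^ l) x) mod int q"
    then have "int q dvd int d * (w + int k * u) - int d * (w + int l * u)"
      using v_Delta_k(2) by (simp add: mod_eq_dvd_iff)
    also have "int d * (w + int k * u) - int d * (w + int l * u) = int d * ((int k - int l) * u)"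
      by (simp add: algebra_simps)
    finally have "int p dvd int k - int l"
      by (simp only: q_dvd_iff p_dvd_iff)
    then show "k = l"
      using less by (simp flip: mod_eq_dvd_iff)
  qed
qed

end

subsection \<open>Upper breaks prime to \<open>p\<close>\<close>

locale coprime_upper_breaks_extension = elementary_abelian_extension +
  assumes coprime_upper_breaks: "\<forall>u\<in>upper_breaks f v \<pi>. \<exists>m::int. u = of_int m \<and> coprime m (int p)"
begin

lemma herbrand_sum_brk:
  assumes "g \<in> G" "g \<noteq> id"
  obtains u where "herbrand_sum (brk g) = int q * u" "coprime u (int p)"
proof -
  obtain u
    where u_eq: "of_int (herbrand_sum (brk g)) / of_nat q = (of_int u :: rat)" "coprime u (int p)"
    using coprime_upper_breaks herbrand_sum_brk_eq_upper_break[OF assms] by blast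
  then have "of_int (herbrand_sum (brk g)) = (of_int (int q * u) :: rat)"
    using q_pos by (simp add: field_simps)
  then show thesis
    using that u_eq(2) by (simp only: of_int_eq_iff)
qed

lemma brk_pos:
  assumes g_nontrivial: "g \<in> G" "g \<noteq> id"
  shows "brk g > 0"
proof (rule ccontr)
  assume "\<not> brk g > 0"
  then have brk_0: "brk g = 0"
    using brk_nonneg[OF g_nontrivial] by simp
  have "0 \<le> brk_ext h" if "h \<in> G" for h
    using brk_nonneg[OF that] brk_le_b_max[OF g_nontrivial] brk_0 by (simp add: brk_ext_def)
  then have "herbrand_sum (brk g) = 0"
    by (simp add: herbrand_sum_def brk_0)
  then show False
    using herbrand_sum_brk[OF g_nontrivial] q_pos prime_gt_1_nat[OF prime_p] by auto
qed

lemma q_dvd_sum_brk_ext: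
  assumes "G \<noteq> {id}"
  shows "int q dvd (\<Sum>g\<in>G. brk_ext g)"
proof -
  obtain g where max_g: "g \<in> G" "g \<noteq> id" "brk g = b_max"
    using b_max_attained[OF assms] .
  have "herbrand_sum b_max = (\<Sum>g\<in>G. brk_ext g)"
    unfolding herbrand_sum_def by (intro sum.cong refl min_absorb1 brk_ext_le_b_max)
  then show ?thesis
    using herbrand_sum_brk[OF max_g(1,2)] max_g(3) by (metis dvd_triv_left)
qed

end

locale max_break_index_p_subgroup =
  coprime_upper_breaks_extension v f \<pi> p + index_p_subgroup v f \<pi> p H s
  for v :: "'n::field_char_0 \<Rightarrow> int" and f :: "'k::field_char_0 \<Rightarrow> 'n" and \<pi> p H s +
  assumes brk_le_brk_s: "g \<in> G \<Longrightarrow> g \<notin> H \<Longrightarrow> brk g \<le> brk s"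
begin

lemma s_neq_id: "s \<noteq> id"
  using s_notin_H by auto

lemma brk_s_comp:
  assumes h_mem: "h \<in> H"
  shows "brk (s \<circ> h) = min (brk_ext h) (brk s)"
proof -
  have outside: "s \<circ> h \<in> G" "s \<circ> h \<notin> H"
    using comp_in_G[OF s_in_G H_in_G[OF h_mem]] comp_notin_H[OF s_in_G s_notin_H h_mem] .
  then have "brk_ext (s \<circ> h) = brk (s \<circ> h)"
    by (auto simp: brk_ext_def)
  then show ?thesis
    using min_brk_ext_comp[OF s_in_G _ H_in_G[OF h_mem], of "brk s"] brk_le_brk_s[OF outside]
      s_neq_id
    by (simp add: brk_ext_def)
qed

lemma conjugate_brk_sum_eq: "conjugate_brk_sum = (\<Sum>h\<in>H. min (brk_ext h) (brk s))"
  by (simp add: conjugate_brk_sum_def brk_s_comp)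

lemma herbrand_sum_brk_s: "herbrand_sum (brk s) = int p * conjugate_brk_sum"
proof -
  have "brk s \<le> brk_ext s"
    using s_neq_id by (simp add: brk_ext_def)
  then have "min (brk_ext (s ^^ i \<circ> h)) (brk s) = min (brk_ext h) (brk s)" if "h \<in> H" for i h
    using that by (intro min_brk_ext_comp le_brk_ext_funpow s_in_G H_in_G)
  then show ?thesis
    by (simp add: herbrand_sum_def sum_G conjugate_brk_sum_eq)
qed

lemma conjugate_brk_sum_pos: "conjugate_brk_sum > 0"
proof -
  have "0 < brk s" "0 < b_max"
    using brk_pos[OF s_in_G s_neq_id] brk_le_b_max[OF s_in_G s_neq_id] by simp_all
  then have "0 < min (brk_ext h) (brk s)" if "h \<in> H" for h
    using brk_pos[OF H_in_G[OF that]] by (simp add: brk_ext_def)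
  then show ?thesis
    unfolding conjugate_brk_sum_eq using d_pos by (intro sum_pos) auto
qed

lemma b_max_brk_sum_cong:
  assumes u_eq: "conjugate_brk_sum = int d * u"
  obtains w where "b_max + brk_sum = int d * w" "[w = u] (mod int p)"
proof -
  have "G \<noteq> {id}"
    using s_in_G s_neq_id by auto
  from q_dvd_sum_brk_ext[OF this] obtain m where m_eq: "(\<Sum>g\<in>G. brk_ext g) = int q * m"
    by (elim dvdE)
  have "(\<Sum>g\<in>G. brk_ext g - min (brk_ext g) (brk s)) = (\<Sum>h\<in>H. brk_ext h - min (brk_ext h) (brk s))"
  proof (rule sum.mono_neutral_right)
    show "\<forall>g\<in>G - H. brk_ext g - min (brk_ext g) (brk s) = 0"
      using brk_le_brk_s id_in_H by (auto simp: brk_ext_def)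
  qed (use H_in_G in auto)
  then have "int q * m - int p * (int d * u) = b_max + brk_sum - int d * u"
    by (simp add: sum_subtractf sum_brk_ext m_eq herbrand_sum_brk_s[unfolded herbrand_sum_def] u_eq
        flip: conjugate_brk_sum_eq)
  then have "b_max + brk_sum = int d * (u + int p * (m - u))"
    by (simp add: q_eq algebra_simps)
  then show thesis
    by (rule that) (simp add: cong_iff_dvd_diff)
qed

lemma trace_conjugates_independent:
  assumes x_cong: "x \<noteq> 0" "[v x = b_max] (mod int q)"
    and zero: "(\<Sum>i<p. f (c i) * (s ^^ i) (trace x)) = 0" and i_less: "i < p"
  shows "c i = 0"
proof -
  obtain u where "herbrand_sum (brk s) = int q * u" and coprime_u: "coprime u (int p)"
    using herbrand_sum_brk[OF s_in_G s_neq_id] .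
  then have u_eq: "conjugate_brk_sum = int d * u"
    using prime_gt_0_nat[OF prime_p] by (simp add: herbrand_sum_brk_s q_eq)
  then have "u > 0"
    using conjugate_brk_sum_pos d_pos by (simp add: zero_less_mult_iff)
  obtain w where w_cong: "b_max + brk_sum = int d * w" "[w = u] (mod int p)"
    using b_max_brk_sum_cong[OF u_eq] .
  obtain l where "v x = b_max + int q * l"
    using x_cong(2) by (metis cong_iff_lin cong_sym)
  then have v_eq: "v x + brk_sum = int d * (w + int p * l)"
    using w_cong(1) by (simp add: q_eq algebra_simps)
  then have "trace x \<noteq> 0" "v (trace x) = int d * (w + int p * l)"
    using v_trace[OF x_cong(1)] by simp_all
  moreover have "[w + int p * l = u] (mod int p)"
    using w_cong(2) by (simp add: cong_def)
  ultimately show ?thesis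
    using v_funpow_Delta_incongruent[OF u_eq \<open>u > 0\<close> coprime_u trace_in_fixed_field]
    by (intro conjugates_independent_if_incongruent[OF _ _ zero i_less]) blast+
qed

end

subsection \<open>The valuation criterion\<close>

context coprime_upper_breaks_extension
begin

lemma max_break_index_p_subgroupI:
  assumes proper: "subgroup H (Gal f)" "H \<noteq> G"
    and maximal: "\<And>s. s \<in> G \<Longrightarrow> s \<notin> H \<Longrightarrow> Gal.adjoin H s = G"
  obtains s where "max_break_index_p_subgroup v f \<pi> p H s"
proof -
  interpret galois_subgroup v f \<pi> H
    by (rule galois_subgroupI[OF proper(1)])
  have "H \<subseteq> G"
    using H_in_G by blast
  then have "Max (brk ` (G - H)) \<in> brk ` (G - H)"
    using proper(2) by (intro Max_in) auto
  then obtain s where max_s: "s \<in> G" "s \<notin> H" "brk s = Max (brk ` (G - H))"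
    by auto
  then have "brk g \<le> brk s" if "g \<in> G" "g \<notin> H" for g
    using that by simp
  then have "max_break_index_p_subgroup v f \<pi> p H s"
    using max_s maximal by unfold_locales auto
  then show thesis
    by (rule that)
qed

theorem generates_normal_basis_if_cong_b_max:
  assumes x_cong: "x \<noteq> 0" "[v x = b_max] (mod int q)"
  shows "generates_normal_basis f x"
  unfolding generates_normal_basis_iff[OF ext card_galois_group]
proof (intro allI impI ballI, rule ccontr)
  fix c g\<^sub>0 assume relation: "(\<Sum>g\<in>G. f (c g) * g x) = 0" and nontrivial_coeff: "g\<^sub>0 \<in> G" "c g\<^sub>0 \<noteq> 0"
  have nontrivial: "carrier (Gal f) \<noteq> {\<one>\<^bsub>Gal f\<^esub>}"
    using relation nontrivial_coeff x_cong(1) by auto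
  obtain H g where proper: "subgroup H (Gal f)" "H \<noteq> G"
    and maximal: "\<And>s. s \<in> G \<Longrightarrow> s \<notin> H \<Longrightarrow> Gal.adjoin H s = G"
    and nonzero_sum: "g \<in> G" "Gal.coset_sum c H g \<noteq> 0"
    using Gal.coset_sum_nonzero_hyperplane[OF nontrivial, of g\<^sub>0 c] nontrivial_coeff by auto
  obtain s where "max_break_index_p_subgroup v f \<pi> p H s"
    using max_break_index_p_subgroupI[OF proper maximal] .
  then interpret max_break_index_p_subgroup v f \<pi> p H s .
  have "(\<Sum>i<p. f (Gal.coset_sum c H (s ^^ i)) * (s ^^ i) (trace x)) = 0"
    unfolding trace_combination[symmetric] relation by (rule trace.zero)
  then have "Gal.coset_sum c H (s ^^ i) = 0" if "i < p" for i
    by (rule trace_conjugates_independent[OF x_cong _ that])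
  then have "Gal.coset_sum c H g = 0"
    using nonzero_sum(1) by (rule coset_sum_eq_0)
  then show False
    using nonzero_sum(2) by simp
qed

theorem not_generates_normal_basis_exists:
  assumes incongruent: "\<not> [w = b_max] (mod int q)"
  obtains x where "x \<noteq> 0" "v x = w" "\<not> generates_normal_basis f x"
proof -
  interpret whole: galois_subgroup v f \<pi> G
    using Gal.subgroup_self by (intro galois_subgroupI) simp
  have "q \<noteq> 1"
    using incongruent by auto
  then have "G \<noteq> {id}"
    using card_galois_group by auto
  then have "int q dvd b_max + whole.brk_sum"
    using q_dvd_sum_brk_ext whole.sum_brk_ext by simp
  then have "\<not> int (card G) dvd w + whole.brk_sum"
    using incongruent dvd_diff[of "int q" "w + whole.brk_sum" "b_max + whole.brk_sum"]
    by (auto simp: card_galois_group cong_iff_dvd_diff)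
  then obtain x where trace_zero: "x \<noteq> 0" "v x = w" "whole.trace x = 0"
    by (rule whole.trace_eq_0_exists)
  have "(\<Sum>g\<in>G. f 1 * g x) = 0"
    using trace_zero(3) by (simp add: whole.trace_def base.one)
  then have "\<not> generates_normal_basis f x"
    unfolding generates_normal_basis_iff[OF ext card_galois_group]
    by (auto intro!: exI[of _ "\<lambda>_. 1"] bexI[of _ id])
  then show thesis
    using that trace_zero(1,2) by blast
qed

end

lemma normalized_valuation_residue_char_pos:
  assumes prime_p: "prime p" and padic: "is_padic_field p a" and emb: "field_embedding j"
    and normalized: "normalized_valuation p a j v"
  shows "v (of_nat p) > 0"
proof -
  interpret j: field_hom j
    using emb by (simp add: field_embedding_iff)
  obtain e where above_p: "e > 0" "\<And>x. x \<noteq> 0 \<Longrightarrow> a x = real p powr (- real_of_int (v (j x)) / e)"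
    using normalized by (auto simp: normalized_valuation_def)
  have p_gt_1: "real p > 1"
    using prime_gt_1_nat[OF prime_p] by simp
  have "multiplicity (int p) (int p) = 1"
    using prime_p by (intro multiplicity_self) auto
  then have "padic_abs p (of_nat p) = inverse (real p)"
    using p_gt_1 by (simp add: padic_abs_def power_int_def)
  moreover have "a (of_rat (of_nat p)) = padic_abs p (of_nat p)"
    using padic unfolding is_padic_field_def by blast
  ultimately have "a (of_nat p) < 1"
    using p_gt_1 by (simp add: inverse_less_1_iff)
  then have "real p powr (- real_of_int (v (j (of_nat p))) / e) < real p powr 0"
    using above_p(2)[of "of_nat p"] p_gt_1 by simp
  then have "- real_of_int (v (j (of_nat p))) / e < 0"
    using p_gt_1 by (simp only: powr_less_cancel_iff)
  then show ?thesis
    using above_p(1) by (simp add: j.of_nat zero_less_divide_iff divide_less_0_iff)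
qed

theorem theorem1:
  fixes p n :: nat
    and absQ :: "'q::field_char_0 \<Rightarrow> real"
    and j :: "'q \<Rightarrow> 'k::field_char_0"
    and f :: "'k \<Rightarrow> 'n::field_char_0"
    and v :: "'n \<Rightarrow> int"
    and \<pi> :: 'n
  assumes "prime p"
    and "is_padic_field p absQ"
    and "finite_extension j"
    and "galois_extension f"
    and "normalized_valuation p absQ (f \<circ> j) v"
    and "prime_element v \<pi>"
    and "totally_ramified f v"
    and "elementary_abelian p (galois_group f)"
    and "card (galois_group f) = p ^ n"
    and "ext_degree f = p ^ n"
    and "\<forall>u \<in> upper_breaks f v \<pi>. \<exists>m::int. u = of_int m \<and> coprime m (int p)"
  defines "b_max \<equiv> Max (lower_breaks f v \<pi>)"
  shows "(\<forall>\<alpha>. \<alpha> \<noteq> 0 \<and> [v \<alpha> = b_max] (mod int (ext_degree f)) \<longrightarrow>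
              generates_normal_basis f \<alpha>)
       \<and> (\<forall>w::int. \<not> [w = b_max] (mod int (ext_degree f)) \<longrightarrow>
              (\<exists>\<rho>. \<rho> \<noteq> 0 \<and> v \<rho> = w \<and> \<not> generates_normal_basis f \<rho>))"
proof -
  have emb: "field_embedding (f \<circ> j)"
    using assms(3,4) by (auto simp: galois_extension_def finite_extension_def field_embedding_def)
  interpret coprime_upper_breaks_extension v f \<pi> p
  proof unfold_locales
    show "\<And>x y. x \<noteq> 0 \<Longrightarrow> y \<noteq> 0 \<Longrightarrow> v (x * y) = v x + v y"
      and "\<And>x y. x \<noteq> 0 \<Longrightarrow> y \<noteq> 0 \<Longrightarrow> x + y \<noteq> 0 \<Longrightarrow> min (v x) (v y) \<le> v (x + y)"
      using assms(5) by (auto simp: normalized_valuation_def)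
    show "v (of_nat p) > 0"
      by (rule normalized_valuation_residue_char_pos[OF assms(1,2) emb assms(5)])
  qed (use assms in \<open>auto simp: galois_extension_def\<close>)
  show ?thesis
    using generates_normal_basis_if_cong_b_max not_generates_normal_basis_exists
    unfolding b_max_def by metis
qed

end
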